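(* Let $r:[0,\bar\epsilon)\to\mathbb{R}$ be continuously differentiable with $r(\epsilon)\ne0$ for $\epsilon\neq0$ and $\lim_{\epsilon\to0}r(\epsilon)=r(0)=\hat r$, where $1/\hat r^2\in\mathsf{Hyp}$ (with $1/0=\infty$). Then there exist $\epsilon_0,\delta_0>0$ such that for every $\mathbf{x}^\dag\in\Sigma_{0,\hat r}$ and every $0\le\epsilon<\epsilon_0$ there is a unique $\mathbf{x}^*=\mathbf{x}^*(\epsilon;\mathbf{x}^\dag)\in\Sigma_\epsilon$ with $|x^*_i-x^\dag_i|<\delta_0$ for all $i\in\mathbb{Z}$, and such that, for every $0<\epsilon<\epsilon_0$, the set $$\mathcal{A}_\epsilon:=\{(x_0^*,x_{-1}^* ):\mathbf{x}^*=\mathbf{x}^*(\epsilon;\mathbf{x}^\dag),\ \mathbf{x}^\dag\in\Sigma_{0,\hat r}\}$$ is quasi-hyperbolic for $H_{1/\epsilon^2,r(\epsilon)/\epsilon}$.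
   Context: An invariant set $S$ of a $C^1$ diffeomorphism $f$ of $\mathbb{R}^k$, $k\ge2$, is called quasi-hyperbolic if, for any orbit $(z_i)_{i\in\mathbb{Z}}$ of $f$ with $z_0\in S$, the recurrence relation $\zeta_{i+1}-Df(z_i)\zeta_i=0$, $i\in\mathbb{Z}$, has no non-trivial bounded solution $(\zeta_i)_{i\in\mathbb{Z}}$. Hénon map: $H_{a,b}(x,y)=(\sqrt a(1-x^2)-by,\;x)$ on $\mathbb{R}^2$. Quadratic map: $Q_a(x)=\sqrt a(1-x^2)$ on $\mathbb{R}$, $a>0$. $Q_a$ is called hyperbolic if it has an attracting periodic orbit (multiplier of modulus $<1$) or if its critical point $0$ goes to infinity under iteration. $\mathsf{Hyp}:=\{a>0: Q_a\text{ is hyperbolic}\}\cup\{\infty\}$. For hyperbolic $Q_a$ with $a>2$, $\Lambda_a$ is the set of points with bounded forward orbit under $Q_a$. For hyperbolic $Q_a$ with $0<a<2$, $\Lambda_a$ is the set of points with bounded forward orbit that do not lie in the basin of attraction of the attracting periodic orbit. $\Lambda_\infty:=\{-1,1\}$. $l_\infty(\mathbb{Z},\mathbb{R})$ is the Banach space of bounded bi-infinite real sequences with the supremum norm; $F_i(\mathbf{x};\epsilon)=\epsilon x_{i+1}-(1-x_i^2)+r(\epsilon)x_{i-1}$, $F=(F_i)_{i\in\mathbb{Z}}$; $\Sigma_\epsilon:=\{\mathbf{x}\in l_\infty(\mathbb{Z},\mathbb{R}):F(\mathbf{x};\epsilon)=0\}$; $\Sigma_{0,\hat r}:=\{\mathbf{x}\in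 l_\infty(\mathbb{Z},\mathbb{R}):F(\mathbf{x};0)=0,\ x_i\in\Lambda_{1/\hat r^2}\ \forall i\}$. *)

theory Defs
  imports "HOL-Analysis.Analysis"
begin

definition C1_map :: "('a::euclidean_space \<Rightarrow> 'a) \<Rightarrow> bool" where
  "C1_map f \<longleftrightarrow> (\<exists>f' :: 'a \<Rightarrow> 'a \<Rightarrow>\<^sub>L 'a.
     (\<forall>x. (f has_derivative blinfun_apply (f' x)) (at x)) \<and> continuous_on UNIV f')"

definition C1_diffeomorphism :: "('a::euclidean_space \<Rightarrow> 'a) \<Rightarrow> bool" where
  "C1_diffeomorphism f \<longleftrightarrow> bij f \<and> C1_map f \<and> C1_map (inv f)"

definition quasi_hyperbolic :: "('a::euclidean_space \<Rightarrow> 'a) \<Rightarrow> 'a set \<Rightarrow> bool" where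
  "quasi_hyperbolic f S \<longleftrightarrow>
     DIM('a) \<ge> 2 \<and> C1_diffeomorphism f \<and> f ` S = S \<and>
     (\<forall>z :: int \<Rightarrow> 'a. (\<forall>i. z (i + 1) = f (z i)) \<and> z 0 \<in> S \<longrightarrow>
        \<not> (\<exists>\<zeta> :: int \<Rightarrow> 'a. bounded (range \<zeta>) \<and> (\<exists>i. \<zeta> i \<noteq> 0) \<and>
             (\<forall>i. \<zeta> (i + 1) - frechet_derivative f (at (z i)) (\<zeta> i) = 0)))"

definition henon :: "real \<Rightarrow> real \<Rightarrow> real \<times> real \<Rightarrow> real \<times> real" where
  "henon a b = (\<lambda>(x, y). (sqrt a * (1 - x\<^sup>2) - b * y, x))"

definition quad_map :: "real \<Rightarrow> real \<Rightarrow> real" where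
  "quad_map a x = sqrt a * (1 - x\<^sup>2)"

text \<open>Below, \<open>n\<close> is the least period, so \<open>deriv (f ^^ n) p\<close> is the multiplier.\<close>

definition attracting_periodic_orbit :: "(real \<Rightarrow> real) \<Rightarrow> real set \<Rightarrow> bool" where
  "attracting_periodic_orbit f P \<longleftrightarrow>
     (\<exists>p n. n > 0 \<and> (f ^^ n) p = p \<and> (\<forall>m. 0 < m \<and> m < n \<longrightarrow> (f ^^ m) p \<noteq> p) \<and>
            \<bar>deriv (f ^^ n) p\<bar> < 1 \<and> P = (\<lambda>k. (f ^^ k) p) ` {..<n})"

definition basin :: "(real \<Rightarrow> real) \<Rightarrow> real set \<Rightarrow> real set" where
  "basin f P = {x. (\<lambda>n. infdist ((f ^^ n) x) P) \<longlonglongrightarrow> 0}"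

definition hyperbolic_quad :: "real \<Rightarrow> bool" where
  "hyperbolic_quad a \<longleftrightarrow>
     (\<exists>P. attracting_periodic_orbit (quad_map a) P) \<or>
     filterlim (\<lambda>n. (quad_map a ^^ n) 0) at_infinity sequentially"

definition Hyp :: "ereal set" where
  "Hyp = {ereal a |a. a > 0 \<and> hyperbolic_quad a} \<union> {\<infinity>}"

definition bounded_orbit_points :: "real \<Rightarrow> real set" where
  "bounded_orbit_points a = {x. bounded (range (\<lambda>n. (quad_map a ^^ n) x))}"

text \<open>Only parameters in \<^const>\<open>Hyp\<close> matter here; \<open>2\<close> is not one of them. A hyperbolic quadratic
  map with \<open>a < 2\<close> has exactly one attracting periodic orbit, so the union over all such
  orbits is its basin.\<close>

definition Lambda :: "ereal \<Rightarrow> real set" where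
  "Lambda \<alpha> =
     (if \<alpha> = \<infinity> then {-1, 1}
      else let a = real_of_ereal \<alpha> in
        if a > 2 then bounded_orbit_points a
        else bounded_orbit_points a -
             (\<Union>P\<in>{P. attracting_periodic_orbit (quad_map a) P}. basin (quad_map a) P))"

definition linf :: "(int \<Rightarrow> real) set" where
  "linf = {x. bounded (range x)}"

definition F :: "(real \<Rightarrow> real) \<Rightarrow> (int \<Rightarrow> real) \<Rightarrow> real \<Rightarrow> int \<Rightarrow> real" where
  "F r x \<epsilon> i = \<epsilon> * x (i + 1) - (1 - (x i)\<^sup>2) + r \<epsilon> * x (i - 1)"

definition sol_set :: "(real \<Rightarrow> real) \<Rightarrow> real \<Rightarrow> (int \<Rightarrow> real) set" where
  "sol_set r \<epsilon> = {x \<in> linf. \<forall>i. F r x \<epsilon> i = 0}"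

text \<open>In \<^typ>\<open>ereal\<close>, \<open>1 / 0 = \<infinity>\<close>.\<close>

definition limit_sol_set :: "(real \<Rightarrow> real) \<Rightarrow> real \<Rightarrow> (int \<Rightarrow> real) set" where
  "limit_sol_set r rhat =
     {x \<in> linf. (\<forall>i. F r x 0 i = 0) \<and> (\<forall>i. x i \<in> Lambda (1 / ereal (rhat\<^sup>2)))}"

definition xstar :: "(real \<Rightarrow> real) \<Rightarrow> real \<Rightarrow> real \<Rightarrow> (int \<Rightarrow> real) \<Rightarrow> int \<Rightarrow> real" where
  "xstar r \<delta> \<epsilon> xd = (THE x. x \<in> sol_set r \<epsilon> \<and> (\<forall>i. \<bar>x i - xd i\<bar> < \<delta>))"

definition continued_set :: "(real \<Rightarrow> real) \<Rightarrow> real \<Rightarrow> real \<Rightarrow> real \<Rightarrow> (real \<times> real) set" where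
  "continued_set r rhat \<delta> \<epsilon> =
     {(xstar r \<delta> \<epsilon> xd 0, xstar r \<delta> \<epsilon> xd (-1)) |xd. xd \<in> limit_sol_set r rhat}"

end

theory Submission
  imports Defs
begin

text \<open>At \<open>\<epsilon> = 0\<close> solutions are, up to sign, backward orbits of the quadratic map \<open>f\<close> inside \<open>\<Lambda>\<close>. Let \<open>E\<close> be
  a forward invariant set that contains the critical value and a neighbourhood of infinity but stays
  away from \<open>\<Lambda>\<close>: the points of large modulus, together with the critical orbit if there is an
  attracting cycle. Inverse branches of \<open>f\<close> map gaps of \<open>E\<close> into gaps of \<open>E\<close>, so by a real Schwarz lemma
  \<open>f\<close> uniformly expands the weight \<open>1 / (y - s) + 1 / (t - y)\<close>, where \<open>(s, t)\<close> is the gap containing \<open>y\<close>.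
  Applied to the attracting cycle itself, the same expansion shows that the cycle attracts the
  critical point, which is why \<open>E\<close> stays away from \<open>\<Lambda>\<close>.

  In the sup norm on sequences weighted accordingly, the equation \<open>F = 0\<close>, solved for \<open>2 * x\<^sup>\<dagger>\<^sub>i\<close> times the
  deviation, is a contraction, uniformly for small \<open>\<epsilon>\<close>. This gives existence and uniqueness of \<open>x\<^sup>*\<close>. The same
  estimate annihilates bounded solutions of the variational equation along \<open>x\<^sup>*\<close>, which is the
  recurrence in the definition of quasi-hyperbolicity.\<close>

section \<open>Expansion in the gaps of an invariant set\<close>

text \<open>This is the density at \<open>y\<close> of the Hilbert metric of the gap of
  \<open>E\<close> around \<open>y\<close>, the one-dimensional counterpart of a Poincare
  density.\<close>

definition gap_weight :: "real set \<Rightarrow> real \<Rightarrow> real" where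
  "gap_weight E y = 1 / (y - Sup {e \<in> E. e < y}) + 1 / (Inf {e \<in> E. y < e} - y)"

definition far_from :: "real \<Rightarrow> real set \<Rightarrow> real \<Rightarrow> bool" where
  "far_from \<delta> E y \<longleftrightarrow> (\<forall>e\<in>E. \<delta> \<le> \<bar>y - e\<bar>)"

text \<open>An interval around \<open>y\<close> free of \<open>E\<close> lies inside the gap of
  \<open>y\<close>, and enlarging an interval lowers its density. The points \<open>u\<close> and
  \<open>v\<close> keep the sets under \<open>Sup\<close> and \<open>Inf\<close> nonempty.\<close>

lemma gap_weight_le:
  assumes "u \<in> E" "v \<in> E" "u < y" "y < v"
    and "a < y" "y < b" "\<And>e. e \<in> E \<Longrightarrow> e \<le> a \<or> b \<le> e"
  shows "gap_weight E y \<le> 1 / (y - a) + 1 / (b - y)"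
proof -
  have "Sup {e \<in> E. e < y} \<le> a"
    using assms by (intro cSup_least) force+
  moreover have "b \<le> Inf {e \<in> E. y < e}"
    using assms by (intro cInf_greatest) force+
  ultimately show ?thesis
    unfolding gap_weight_def using assms(5,6)
    by (intro add_mono divide_left_mono mult_pos_pos) auto
qed

text \<open>The map is \<open>x \<mapsto> c * (1 - x\<^sup>2)\<close> with \<open>c\<close> standing
  for \<open>sqrt a\<close>. \<open>outer\<close> makes the relevant gaps bounded,
  \<open>critical_value\<close> keeps a gap that meets the image below \<open>c\<close>, so that it
  can be pulled back, and \<open>invariant\<close> makes its preimages free of
  \<open>E\<close>.\<close>

locale trapped_quadratic =
  fixes c M \<delta> :: real and E :: "real set"
  assumes c_pos: "0 < c" and delta_pos: "0 < \<delta>"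
    and outer: "\<And>x. M \<le> \<bar>x\<bar> \<Longrightarrow> x \<in> E"
    and critical_value: "c \<in> E"
    and invariant: "\<And>x. x \<in> E \<Longrightarrow> c * (1 - x\<^sup>2) \<in> E"
begin

text \<open>The ends of the gap around \<open>y\<close>. \<open>E\<close> is not assumed closed, so
  they need not belong to it.\<close>

definition s where "s y = Sup {e \<in> E. e < y}"
definition t where "t y = Inf {e \<in> E. y < e}"

lemma far_abs_less:
  assumes "far_from \<delta> E y" shows "\<bar>y\<bar> < M"
proof (rule ccontr)
  assume "\<not> \<bar>y\<bar> < M"
  then have "y \<in> E" using outer by simp
  then show False using assms delta_pos unfolding far_from_def by force
qed

lemma gap:
  assumes "far_from \<delta> E y"
  shows "-M \<le> s y" "s y \<le> y - \<delta>" "y + \<delta> \<le> t y" "t y \<le> M"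
    and "\<And>e. e \<in> E \<Longrightarrow> e \<le> s y \<or> t y \<le> e"
    and "gap_weight E y = 1 / (y - s y) + 1 / (t y - y)"
proof -
  have y: "\<bar>y\<bar> < M" by (rule far_abs_less[OF assms])
  have E: "-M \<in> E" "M \<in> E" using y by (auto intro!: outer)
  have lo: "e \<le> y - \<delta>" if "e \<in> E" "e < y" for e
    using assms that unfolding far_from_def by force
  have hi: "y + \<delta> \<le> e" if "e \<in> E" "y < e" for e
    using assms that unfolding far_from_def by force
  have ba: "bdd_above {e \<in> E. e < y}" by (intro bdd_aboveI[of _ y]) auto
  have bb: "bdd_below {e \<in> E. y < e}" by (intro bdd_belowI[of _ y]) auto
  have *: "e \<le> s y" if "e \<in> E" "e < y" for e
    unfolding s_def using ba that by (intro cSup_upper) auto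
  have **: "t y \<le> e" if "e \<in> E" "y < e" for e
    unfolding t_def using bb that by (intro cInf_lower) auto
  show "-M \<le> s y" "t y \<le> M" using * ** E y by auto
  show "s y \<le> y - \<delta>" unfolding s_def using E y lo by (intro cSup_least) force+
  show "y + \<delta> \<le> t y" unfolding t_def using E y hi by (intro cInf_greatest) force+
  show "e \<le> s y \<or> t y \<le> e" if "e \<in> E" for e
  proof -
    have "e \<noteq> y" using that assms delta_pos unfolding far_from_def by force
    then show ?thesis using * ** that by (meson linorder_less_linear)
  qed
  show "gap_weight E y = 1 / (y - s y) + 1 / (t y - y)"
    by (simp add: gap_weight_def s_def t_def)
qed

text \<open>A gap has length at most \<open>2 * M\<close>, and its ends are at least \<delta> away
  from \<open>y\<close>. Hence the weighted sup norm is uniformly equivalent to the plain one; the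
  two bounds later serve as \<open>c1\<close> and \<open>c2\<close>.\<close>

lemma gap_weight_bounds:
  assumes "far_from \<delta> E y"
  shows "1 / M \<le> gap_weight E y" "gap_weight E y \<le> 2 / \<delta>"
proof -
  note g = gap[OF assms] and y = far_abs_less[OF assms]
  have "1 / (2*M) \<le> 1 / (y - s y)" "1 / (2*M) \<le> 1 / (t y - y)"
    using g(1-4) y delta_pos by (intro divide_left_mono mult_pos_pos; linarith)+
  moreover have "1 / M = 1 / (2*M) + 1 / (2*M)" by simp
  ultimately show "1 / M \<le> gap_weight E y" unfolding g(6) by linarith
  have "1 / (y - s y) \<le> 1 / \<delta>" "1 / (t y - y) \<le> 1 / \<delta>"
    using g(1-4) y delta_pos by (intro divide_left_mono mult_pos_pos; linarith)+
  then show "gap_weight E y \<le> 2 / \<delta>" unfolding g(6) by linarith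
qed

text \<open>A uniform lower bound for the factor in \<open>expansion_identity\<close>: each
  difference of squares there is at least \<open>\<delta> / c\<close>, each squared sum at most
  \<open>4 * (1 + M / c)\<close>.\<close>

definition rate where "rate = 1 + (\<delta> / c)\<^sup>2 / (16 * (1 + M / c)\<^sup>2)"

text \<open>A far point forces \<open>0 < M\<close>, so the denominator in \<open>rate\<close> is
  positive.\<close>

lemma rate_gt_1: "far_from \<delta> E y \<Longrightarrow> 1 < rate"
  using far_abs_less[of y] delta_pos c_pos
  by (auto simp: rate_def intro!: divide_pos_pos add_pos_pos zero_less_power)
     (smt (verit) divide_nonneg_pos)

text \<open>The critical value has 0 as its only preimage, so a value far from \<open>c\<close>
  keeps \<open>x\<close> away from 0. This also bounds limit solutions away from 0.\<close>

lemma far_value: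
  assumes "far_from \<delta> E (c * (1 - x\<^sup>2))"
  shows "\<delta> / c \<le> x\<^sup>2"
proof -
  have "\<delta> \<le> \<bar>c * (1 - x\<^sup>2) - c\<bar>" using assms critical_value by (simp add: far_from_def)
  also have "c * (1 - x\<^sup>2) - c = - (c * x\<^sup>2)" by (simp add: algebra_simps)
  finally show ?thesis using c_pos by (simp add: field_simps abs_mult)
qed

text \<open>Squaring maps the interval from \<open>V\<close> to \<open>U\<close> onto the one from
  \<open>V\<^sup>2\<close> to \<open>U\<^sup>2\<close>. The left side is the image density times the
  derivative \<open>2 * X\<close>, the right side the source density times an explicit factor above
  1; both split into linear factors.\<close>

lemma expansion_identity:
  fixes X U V :: real
  assumes "0 < X" "0 \<le> V" "V < X" "X < U"
  shows "2 * X * (1 / (U\<^sup>2 - X\<^sup>2) + 1 / (X\<^sup>2 - V\<^sup>2)) =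
    (1 + (U\<^sup>2 - X\<^sup>2) * (X\<^sup>2 - V\<^sup>2) / ((U + X)\<^sup>2 * (X + V)\<^sup>2)) * (1 / (U - X) + 1 / (X - V))"
proof -
  have e: "U\<^sup>2 - X\<^sup>2 = (U - X) * (U + X)" "X\<^sup>2 - V\<^sup>2 = (X - V) * (X + V)"
    by (simp_all add: algebra_simps power2_eq_square)
  have nz: "U - X \<noteq> 0" "U + X \<noteq> 0" "X - V \<noteq> 0" "X + V \<noteq> 0" using assms by auto
  have s: "1 / (U - X) + 1 / (X - V) = (U - V) / ((U - X) * (X - V))"
    using nz by (simp add: field_simps)
  have l: "1 / ((U - X) * (U + X)) + 1 / ((X - V) * (X + V)) =
      ((X - V) * (X + V) + (U - X) * (U + X)) / ((U - X) * (U + X) * ((X - V) * (X + V)))"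
    using nz by (subst add_frac_eq) auto
  have r: "1 + (U - X) * (U + X) * ((X - V) * (X + V)) / ((U + X)\<^sup>2 * (X + V)\<^sup>2) =
      ((U + X) * (X + V) + (U - X) * (X - V)) / ((U + X) * (X + V))"
    using nz by (simp add: power2_eq_square add_divide_distrib)
  show ?thesis unfolding e s l r using nz
    by (simp add: frac_eq_eq) (simp add: algebra_simps power2_eq_square power3_eq_cube)
qed

text \<open>A one-dimensional Schwarz lemma: branches of the inverse map gaps of \<open>E\<close> into gaps of \<open>E\<close>
  and are strict contractions for the weight \<open>1 / (y - s) + 1 / (t - y)\<close>, because quadratic
  maps have negative Schwarzian derivative.\<close>

lemma gap_weight_expansion:
  assumes x: "far_from \<delta> E x" and y: "far_from \<delta> E (c * (1 - x\<^sup>2))"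
  shows "rate * gap_weight E x \<le> 2 * c * \<bar>x\<bar> * gap_weight E (c * (1 - x\<^sup>2))"
proof -
  define y where "y = c * (1 - x\<^sup>2)"
  define X where "X = \<bar>x\<bar>"
  \<comment> \<open>\<open>U\<close> and \<open>V\<close> are the nonnegative preimages of the ends
    \<open>s y\<close> and \<open>t y\<close>. The map decreases in the modulus of its argument, so
    the lower end gives the outer point \<open>U\<close>.\<close>
  define U where "U = sqrt (1 - s y / c)"
  define V where "V = sqrt (1 - t y / c)"
  note g = gap[OF y, folded y_def]
  have M: "\<bar>x\<bar> < M" "\<bar>y\<bar> < M" using far_abs_less x y unfolding y_def by auto
  have x2: "\<delta> / c \<le> X\<^sup>2" using far_value[OF y] by (simp add: X_def)
  have dc: "0 < \<delta> / c" using delta_pos c_pos by simp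
  have X: "0 < X" using x2 dc by (auto simp: X_def)
  have yX: "y = c * (1 - X\<^sup>2)" by (simp add: y_def X_def)
  have yc: "y < c" using yX X c_pos by (simp add: mult_less_cancel_left1)
  \<comment> \<open>The critical value closes the gap from above, so the radicand of
    \<open>V\<close> is nonnegative.\<close>
  have tc: "t y \<le> c" using g(5)[OF critical_value] g(2) yc delta_pos by linarith
  have U2: "U\<^sup>2 = 1 - s y / c" unfolding U_def
    using g(2) yc c_pos delta_pos by (intro real_sqrt_pow2) (simp add: divide_simps)
  have V2: "V\<^sup>2 = 1 - t y / c" unfolding V_def
    using tc c_pos by (intro real_sqrt_pow2) (simp add: divide_simps)
  have U0: "0 \<le> U" and V0: "0 \<le> V"
    unfolding U_def V_def using U2 V2 U_def V_def zero_le_power2 by (metis real_sqrt_ge_zero)+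
  have sU: "y - s y = c * (U\<^sup>2 - X\<^sup>2)" using c_pos by (simp add: U2 yX field_simps)
  have tV: "t y - y = c * (X\<^sup>2 - V\<^sup>2)" using c_pos by (simp add: V2 yX field_simps)
  have UX: "\<delta> / c \<le> U\<^sup>2 - X\<^sup>2" using sU g(2) c_pos by (simp add: field_simps)
  have XV: "\<delta> / c \<le> X\<^sup>2 - V\<^sup>2" using tV g(3) c_pos by (simp add: field_simps)
  have ltU: "X < U" using UX dc U0 by (intro power_less_imp_less_base[of X 2 U]) auto
  have ltV: "V < X" using XV dc X by (intro power_less_imp_less_base[of V 2 X]) auto
  \<comment> \<open>A point of \<open>E\<close> with modulus strictly between \<open>V\<close> and
    \<open>U\<close> would be mapped to a point of \<open>E\<close> inside the gap of
    \<open>y\<close>.\<close>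
  have nE: "\<bar>e\<bar> \<le> V \<or> U \<le> \<bar>e\<bar>" if "e \<in> E" for e
  proof (rule ccontr)
    assume "\<not> ?thesis"
    then have "V\<^sup>2 < e\<^sup>2" "e\<^sup>2 < U\<^sup>2"
      using V0 power_strict_mono[of V "\<bar>e\<bar>" 2] power_strict_mono[of "\<bar>e\<bar>" U 2] by auto
    then have "s y < c * (1 - e\<^sup>2)" "c * (1 - e\<^sup>2) < t y"
      using c_pos by (auto simp: U2 V2 field_simps)
    then show False using g(5)[OF invariant[OF that]] by linarith
  qed
  have E: "-M \<in> E" "M \<in> E" using M by (auto intro!: outer)
  \<comment> \<open>The sign of \<open>x\<close> selects the inverse branch: the pulled back
    interval runs from \<open>V\<close> to \<open>U\<close> or from \<open>-U\<close> to
    \<open>-V\<close>.\<close>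
  have le: "gap_weight E x \<le> 1 / (U - X) + 1 / (X - V)"
  proof (cases "0 \<le> x")
    case True
    have "gap_weight E x \<le> 1 / (x - V) + 1 / (U - x)"
    proof (rule gap_weight_le[of "-M" E M])
      show "e \<le> V \<or> U \<le> e" if "e \<in> E" for e using nE[OF that] V0 by linarith
    qed (use E M ltU ltV True in \<open>auto simp: X_def\<close>)
    then show ?thesis using True by (simp add: X_def)
  next
    case False
    have "gap_weight E x \<le> 1 / (x - (-U)) + 1 / (-V - x)"
    proof (rule gap_weight_le[of "-M" E M])
      show "e \<le> -U \<or> -V \<le> e" if "e \<in> E" for e using nE[OF that] V0 by linarith
    qed (use E M ltU ltV False in \<open>auto simp: X_def\<close>)
    then show ?thesis using False by (simp add: X_def add.commute minus_diff_commute)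
  qed
  have B: "U\<^sup>2 \<le> 1 + M / c"
    using divide_right_mono[of "- s y" M c] g(1) c_pos by (simp add: U2)
  have "(U + X)\<^sup>2 \<le> (2*U)\<^sup>2" "(X + V)\<^sup>2 \<le> (2*U)\<^sup>2"
    using ltU ltV V0 X by (intro power_mono; simp)+
  then have "(U + X)\<^sup>2 \<le> 4 * (1 + M/c)" "(X + V)\<^sup>2 \<le> 4 * (1 + M/c)"
    using B by (auto simp: power_mult_distrib)
  then have den: "(U + X)\<^sup>2 * (X + V)\<^sup>2 \<le> (4 * (1 + M/c)) * (4 * (1 + M/c))"
    by (rule mult_mono) (use M c_pos in auto)
  have num: "(\<delta>/c) * (\<delta>/c) \<le> (U\<^sup>2 - X\<^sup>2) * (X\<^sup>2 - V\<^sup>2)"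
    using UX XV dc by (intro mult_mono) auto
  have "(\<delta> / c)\<^sup>2 / (16 * (1 + M / c)\<^sup>2) = (\<delta>/c) * (\<delta>/c) / ((4 * (1 + M/c)) * (4 * (1 + M/c)))"
    by (simp add: power2_eq_square algebra_simps)
  also have "\<dots> \<le> (U\<^sup>2 - X\<^sup>2) * (X\<^sup>2 - V\<^sup>2) / ((U + X)\<^sup>2 * (X + V)\<^sup>2)"
    using ltU ltV V0 X dc num by (intro frac_le num den) (auto intro!: mult_pos_pos)
  finally have rate: "rate \<le> 1 + (U\<^sup>2 - X\<^sup>2) * (X\<^sup>2 - V\<^sup>2) / ((U + X)\<^sup>2 * (X + V)\<^sup>2)"
    by (simp add: rate_def)
  have "rate * gap_weight E x \<le> rate * (1 / (U - X) + 1 / (X - V))"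
    using le rate_gt_1[OF x] by (intro mult_left_mono) auto
  also have "\<dots> \<le> (1 + (U\<^sup>2 - X\<^sup>2) * (X\<^sup>2 - V\<^sup>2) / ((U + X)\<^sup>2 * (X + V)\<^sup>2)) * (1 / (U - X) + 1 / (X - V))"
    using rate ltU ltV by (intro mult_right_mono) auto
  also have "\<dots> = 2 * X * (1 / (U\<^sup>2 - X\<^sup>2) + 1 / (X\<^sup>2 - V\<^sup>2))"
    using expansion_identity[of X V U] X V0 ltV ltU by simp
  also have "\<dots> = 2 * c * X * gap_weight E y"
    unfolding g(6) sU tV using c_pos by (simp add: distrib_left)
  finally show ?thesis by (simp add: X_def y_def)
qed

end

section \<open>Hyperbolicity of quadratic maps\<close>

lemma has_real_derivative_funpow:
  fixes f f' :: "real \<Rightarrow> real"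
  assumes "\<And>x. (f has_real_derivative f' x) (at x)"
  shows "((f ^^ n) has_real_derivative (\<Prod>k<n. f' ((f ^^ k) x))) (at x)"
proof (induction n)
  case 0
  show ?case by (simp add: id_def)
next
  case (Suc n)
  have "((\<lambda>x. f ((f ^^ n) x)) has_real_derivative f' ((f ^^ n) x) * (\<Prod>k<n. f' ((f ^^ k) x))) (at x)"
    by (rule DERIV_chain2[OF assms Suc])
  then show ?case by (simp add: o_def mult.commute)
qed

lemma funpow_in_basin_iff: "(f ^^ k) y \<in> basin f P \<longleftrightarrow> y \<in> basin f P"
proof -
  have "(f ^^ n) ((f ^^ k) y) = (f ^^ (n + k)) y" for n by (simp add: funpow_add)
  then show ?thesis
    unfolding basin_def mem_Collect_eq
    using LIMSEQ_ignore_initial_segment[of "\<lambda>n. infdist ((f ^^ n) y) P" 0 k]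
      LIMSEQ_offset[of "\<lambda>n. infdist ((f ^^ n) y) P" k 0] by auto
qed

text \<open>The contraction is towards \<open>p\<close> only, so it can be read off the difference
  quotients at \<open>p\<close>, without a mean value argument.\<close>

lemma local_contraction:
  fixes g :: "real \<Rightarrow> real"
  assumes "(g has_real_derivative D) (at p)" "\<bar>D\<bar> < 1" "g p = p"
  shows "\<exists>\<eta>>0. \<forall>y. \<bar>y - p\<bar> < \<eta> \<longrightarrow> (\<lambda>j. (g ^^ j) y) \<longlonglongrightarrow> p"
proof -
  obtain \<mu> where \<mu>: "\<bar>D\<bar> < \<mu>" "\<mu> < 1" using dense assms(2) by blast
  have "((\<lambda>y. (g y - g p) / (y - p)) \<longlongrightarrow> D) (at p)"
    using assms(1) by (simp add: has_field_derivative_iff)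
  then have "((\<lambda>y. \<bar>(g y - g p) / (y - p)\<bar>) \<longlongrightarrow> \<bar>D\<bar>) (at p)"
    by (rule tendsto_rabs)
  then have "\<forall>\<^sub>F y in at p. \<bar>(g y - g p) / (y - p)\<bar> < \<mu>"
    using \<mu>(1) by (rule order_tendstoD(2))
  then obtain \<eta> where \<eta>: "0 < \<eta>"
    and *: "\<And>y. y \<noteq> p \<Longrightarrow> \<bar>y - p\<bar> < \<eta> \<Longrightarrow> \<bar>(g y - g p) / (y - p)\<bar> < \<mu>"
    by (auto simp: eventually_at dist_real_def)
  have c: "\<bar>g y - p\<bar> \<le> \<mu> * \<bar>y - p\<bar>" if "\<bar>y - p\<bar> < \<eta>" for y
    using *[of y] that assms(3) by (cases "y = p") (auto simp: abs_divide divide_simps)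
  have "(\<lambda>j. (g ^^ j) y) \<longlonglongrightarrow> p" if y: "\<bar>y - p\<bar> < \<eta>" for y
  proof -
    have b: "\<bar>(g ^^ j) y - p\<bar> \<le> \<mu> ^ j * \<bar>y - p\<bar>" for j
    proof (induction j)
      case (Suc j)
      have "\<mu> ^ j * \<bar>y - p\<bar> \<le> 1 * \<bar>y - p\<bar>"
        using \<mu> by (intro mult_right_mono power_le_one) auto
      then have "\<bar>(g ^^ j) y - p\<bar> < \<eta>" using Suc y by (simp only: mult_1_left)
      from c[OF this] have "\<bar>(g ^^ Suc j) y - p\<bar> \<le> \<mu> * \<bar>(g ^^ j) y - p\<bar>" by simp
      also have "\<dots> \<le> \<mu> * (\<mu> ^ j * \<bar>y - p\<bar>)" using Suc \<mu> by (intro mult_left_mono) auto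
      finally show ?case by (simp add: mult.assoc)
    qed simp
    have "(\<lambda>j. \<mu> ^ j * \<bar>y - p\<bar>) \<longlonglongrightarrow> 0"
      using \<mu> by (intro tendsto_mult_left_zero LIMSEQ_power_zero) auto
    then have "(\<lambda>j. (g ^^ j) y - p) \<longlonglongrightarrow> 0"
      by (rule Lim_null_comparison[rotated]) (use b in simp)
    then show ?thesis by (simp add: LIM_zero_iff)
  qed
  then show ?thesis using \<eta> by blast
qed

text \<open>Openness holds because the basin is the union of all iterated preimages of one small
  ball around a point of the cycle.\<close>

lemma attracting_periodic_orbit_basin:
  fixes f f' :: "real \<Rightarrow> real"
  assumes attr: "attracting_periodic_orbit f P"
    and der: "\<And>x. (f has_real_derivative f' x) (at x)"
  shows "finite P" "P \<noteq> {}" "f ` P \<subseteq> P"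
    and "\<exists>p\<in>P. \<exists>n>0. (f ^^ n) p = p \<and> \<bar>\<Prod>k<n. f' ((f ^^ k) p)\<bar> < 1"
    and "P \<subseteq> basin f P" "open (basin f P)"
proof -
  obtain p n where n: "n > 0" and p: "(f ^^ n) p = p" and D: "\<bar>deriv (f ^^ n) p\<bar> < 1"
    and P: "P = (\<lambda>k. (f ^^ k) p) ` {..<n}"
    using attr unfolding attracting_periodic_orbit_def by blast
  note dn = has_real_derivative_funpow[OF der]
  have cont: "continuous_on UNIV (f ^^ k)" for k
    using dn by (meson DERIV_isCont continuous_at_imp_continuous_on)
  have D': "\<bar>\<Prod>k<n. f' ((f ^^ k) p)\<bar> < 1" using D DERIV_imp_deriv[OF dn] by simp
  have pP: "p \<in> P" using n unfolding P by (force intro: image_eqI[of _ _ 0])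
  show fin: "finite P" and ne: "P \<noteq> {}" using n by (auto simp: P)
  show "\<exists>p\<in>P. \<exists>n>0. (f ^^ n) p = p \<and> \<bar>\<Prod>k<n. f' ((f ^^ k) p)\<bar> < 1"
    using pP n p D' by blast
  show "f ` P \<subseteq> P"
  proof clarify
    fix q assume "q \<in> P"
    then obtain k where k: "k < n" "q = (f ^^ k) p" by (auto simp: P)
    show "f q \<in> P"
    proof (cases "Suc k = n")
      case True
      then have "f q = p" using p k by auto
      then show ?thesis using pP by simp
    next
      case False
      then have "Suc k < n" "f q = (f ^^ Suc k) p" using k by auto
      then show ?thesis unfolding P by blast
    qed
  qed
  obtain \<eta> where \<eta>: "0 < \<eta>"
    and conv: "\<And>y. \<bar>y - p\<bar> < \<eta> \<Longrightarrow> (\<lambda>j. ((f ^^ n) ^^ j) y) \<longlonglongrightarrow> p"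
    using local_contraction[OF dn D' p] by blast
  have near: "y \<in> basin f P" if y: "\<bar>y - p\<bar> < \<eta>" for y
  proof -
    \<comment> \<open>Write \<open>m\<close> as \<open>n * (m div n) + m mod n\<close>. Summing over
      all residues gives one null sequence that dominates the distance to \<open>P\<close> whatever
      the residue of \<open>m\<close> is.\<close>
    define a where "a = (\<lambda>m. \<Sum>i<n. \<bar>(f ^^ i) (((f ^^ n) ^^ (m div n)) y) - (f ^^ i) p\<bar>)"
    have "filterlim (\<lambda>m. m div n) at_top sequentially"
    proof (rule filterlim_at_top_mono[OF _ always_eventually])
      show "filterlim (\<lambda>m. nat \<lfloor>real m / real n\<rfloor>) at_top sequentially"
        using n by real_asymp
      show "\<forall>m. nat \<lfloor>real m / real n\<rfloor> \<le> m div n"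
        by (simp add: floor_divide_of_nat_eq)
    qed
    then have "(\<lambda>m. ((f ^^ n) ^^ (m div n)) y) \<longlonglongrightarrow> p"
      using conv[OF y] by (rule filterlim_compose[rotated])
    then have "(\<lambda>m. (f ^^ i) (((f ^^ n) ^^ (m div n)) y)) \<longlonglongrightarrow> (f ^^ i) p" for i
      by (rule continuous_on_tendsto_compose[OF cont]) auto
    then have "a \<longlonglongrightarrow> 0"
      unfolding a_def by (intro tendsto_null_sum tendsto_rabs_zero) (simp add: LIM_zero)
    moreover have "infdist ((f ^^ m) y) P \<le> a m" for m
    proof -
      let ?i = "m mod n"
      have "((f ^^ n) ^^ (m div n)) y = (f ^^ (n * (m div n))) y"
        by (simp add: funpow_mult)
      then have eq: "(f ^^ ?i) (((f ^^ n) ^^ (m div n)) y) = (f ^^ m) y"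
        by (metis comp_apply funpow_add mod_mult_div_eq)
      have "(f ^^ ?i) p \<in> P" using n by (auto simp: P)
      then have "infdist ((f ^^ m) y) P \<le> \<bar>(f ^^ m) y - (f ^^ ?i) p\<bar>"
        using infdist_le[of _ P] by (simp add: dist_real_def)
      also have "\<dots> \<le> a m"
        unfolding a_def eq[symmetric]
        by (rule member_le_sum[of ?i _ "\<lambda>i. \<bar>(f ^^ i) (((f ^^ n) ^^ (m div n)) y) - (f ^^ i) p\<bar>"])
          (use n in auto)
      finally show ?thesis .
    qed
    then have "\<forall>\<^sub>F m in sequentially. norm (infdist ((f ^^ m) y) P) \<le> a m"
      by (simp add: infdist_nonneg)
    ultimately have "(\<lambda>m. infdist ((f ^^ m) y) P) \<longlonglongrightarrow> 0"
      by (rule Lim_null_comparison[rotated])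
    then show ?thesis by (simp add: basin_def)
  qed
  define W where "W = (\<Union>k. (f ^^ k) -` ball p \<eta>)"
  have oW: "open W" unfolding W_def
    by (intro open_UN ballI open_vimage cont) auto
  have Wb: "W \<subseteq> basin f P"
    using near funpow_in_basin_iff unfolding W_def
    by (fastforce simp: dist_real_def abs_minus_commute)
  have PW: "P \<subseteq> W"
  proof
    fix q assume "q \<in> P"
    then obtain k where k: "k < n" "q = (f ^^ k) p" by (auto simp: P)
    then have "(f ^^ (n - k)) q = p"
      by (metis comp_apply funpow_add le_add_diff_inverse2 less_imp_le p)
    then have "q \<in> (f ^^ (n - k)) -` ball p \<eta>" using \<eta> by simp
    then show "q \<in> W" unfolding W_def by blast
  qed
  then show "P \<subseteq> basin f P" using Wb by blast
  \<comment> \<open>\<open>W\<close> is a neighbourhood of the finite set \<open>P\<close>, so an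
    orbit converging to \<open>P\<close> enters \<open>W\<close> and from there the ball around
    \<open>p\<close>.\<close>
  have "basin f P \<subseteq> W"
  proof
    fix y assume "y \<in> basin f P"
    then have lim: "(\<lambda>m. infdist ((f ^^ m) y) P) \<longlonglongrightarrow> 0" by (simp add: basin_def)
    obtain e where e: "0 < e" "(\<Union>q\<in>P. ball q e) \<subseteq> W"
      using compact_subset_open_imp_ball_epsilon_subset[OF finite_imp_compact[OF fin] oW PW] by blast
    obtain m where "infdist ((f ^^ m) y) P < e"
      using order_tendstoD(2)[OF lim e(1)] by (auto simp: eventually_sequentially)
    then obtain q where "q \<in> P" "dist ((f ^^ m) y) q < e"
      by (metis finite_imp_compact[OF fin] compact_imp_closed infdist_attains_inf ne)
    then have "(f ^^ m) y \<in> W" using e(2) by (force simp: dist_commute)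
    then obtain k where "(f ^^ (k + m)) y \<in> ball p \<eta>"
      unfolding W_def by (auto simp: funpow_add)
    then show "y \<in> W" unfolding W_def by blast
  qed
  then show "open (basin f P)" using oW Wb by (metis subset_antisym)
qed

text \<open>\<open>- \<beta>\<close> is the orientation preserving repelling fixed point of \<open>x \<mapsto> c * (1 - x\<^sup>2)\<close>, and \<open>\<beta>\<close> is its
  other preimage.\<close>

lemma quadratic_fixed_point:
  fixes c :: real
  assumes "0 < c"
  obtains \<beta> where "0 < \<beta>" "c * \<beta>\<^sup>2 = \<beta> + c" "1 < c * \<beta>"
proof
  define D where "D = sqrt (1 + 4 * c\<^sup>2)"
  have D: "D\<^sup>2 = 1 + 4 * c\<^sup>2" unfolding D_def by (intro real_sqrt_pow2) auto
  have D1: "1 < D" unfolding D_def using assms by simp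
  show "0 < (1 + D) / (2 * c)" using D1 assms by simp
  have "(1 + D)\<^sup>2 = 2 * (1 + D) + 4 * c\<^sup>2" using D by (simp add: power2_sum)
  then show "c * ((1 + D) / (2 * c))\<^sup>2 = (1 + D) / (2 * c) + c"
    using assms by (simp add: power_divide power_mult_distrib field_simps power2_eq_square)
  show "1 < c * ((1 + D) / (2 * c))" using D1 assms by simp
qed

section \<open>Escape to infinity and the critical orbit\<close>

context
  fixes c \<beta> :: real
  assumes c: "0 < c" and \<beta>: "0 < \<beta>" "c * \<beta>\<^sup>2 = \<beta> + c" "1 < c * \<beta>"
begin

text \<open>The slope at \<beta> has modulus \<open>2 * c * \<beta> > 2\<close> and grows further
  out, so outside the interval from -\<beta> to \<beta> the distance to it at least doubles.\<close>

lemma quadratic_escape: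
  assumes "\<beta> + d \<le> \<bar>x\<bar>" "0 \<le> d"
  shows "\<beta> + 2 * d \<le> \<bar>c * (1 - x\<^sup>2)\<bar>"
proof -
  have "(\<beta> + d)\<^sup>2 \<le> \<bar>x\<bar>\<^sup>2" using assms \<beta> by (intro power_mono) auto
  then have "c * (\<beta> + d)\<^sup>2 \<le> c * x\<^sup>2" using c by simp
  moreover have "c * (\<beta> + d)\<^sup>2 = \<beta> + c + 2 * (c * \<beta>) * d + c * d\<^sup>2"
    using \<beta>(2) by (simp add: power2_sum algebra_simps)
  moreover have "1 * d \<le> (c * \<beta>) * d" using assms(2) \<beta>(3) by (intro mult_right_mono) auto
  moreover have "0 \<le> c * d\<^sup>2" using c by simp
  ultimately show ?thesis by (simp add: algebra_simps abs_if)
qed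

lemma bounded_orbit_abs_le:
  assumes "bounded (range (\<lambda>n. ((\<lambda>x. c * (1 - x\<^sup>2)) ^^ n) x))"
  shows "\<bar>x\<bar> \<le> \<beta>"
proof (rule ccontr)
  assume *: "\<not> \<bar>x\<bar> \<le> \<beta>"
  define d where "d = \<bar>x\<bar> - \<beta>"
  have d: "0 < d" using * by (simp add: d_def)
  let ?f = "\<lambda>x. c * (1 - x\<^sup>2)"
  have grow: "\<beta> + 2 ^ n * d \<le> \<bar>(?f ^^ n) x\<bar>" for n
  proof (induction n)
    case (Suc n)
    show ?case using quadratic_escape[OF Suc] d by (simp add: mult.assoc)
  qed (simp add: d_def)
  obtain B where B: "\<And>n. \<bar>(?f ^^ n) x\<bar> \<le> B"
    using assms by (auto simp: bounded_iff)
  obtain n where "B / d < 2 ^ n" using real_arch_pow[of 2 "B / d"] by auto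
  then have "B < 2 ^ n * d" using d by (simp add: field_simps)
  then show False using grow[of n] B[of n] \<beta> by linarith
qed

text \<open>\<beta> solves \<open>x * (c * x - 1) = c\<close>, and at \<open>x = c\<close> the left
  side is already too large. For such parameters the critical value lies in the escaping
  region.\<close>

lemma fixed_point_less_critical_value:
  assumes "2 < c\<^sup>2" shows "\<beta> < c"
proof (rule ccontr)
  assume "\<not> \<beta> < c"
  then have "c * (c * c - 1) \<le> \<beta> * (c * \<beta> - 1)"
    using c assms by (intro mult_mono) (auto simp: power2_eq_square)
  also have "\<dots> = c" using \<beta>(2) by (simp add: power2_eq_square algebra_simps)
  finally have "c * (c\<^sup>2 - 2) \<le> 0" by (simp add: power2_eq_square algebra_simps)
  then show False using c assms by (simp add: mult_le_0_iff)
qed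

lemma critical_value_le_fixed_point:
  assumes "c\<^sup>2 \<le> 2" shows "c \<le> \<beta>"
proof (rule ccontr)
  assume *: "\<not> c \<le> \<beta>"
  then have "c * \<beta> < c * c" using c by simp
  then have "c * \<beta> - 1 \<le> 1" using assms by (simp add: power2_eq_square)
  then have "\<beta> * (c * \<beta> - 1) \<le> \<beta> * 1" using \<beta> by (intro mult_left_mono) auto
  moreover have "\<beta> * (c * \<beta> - 1) = c" using \<beta>(2) by (simp add: power2_eq_square algebra_simps)
  ultimately show False using * by linarith
qed

text \<open>When \<open>c \<le> \<beta>\<close>, the interval from -\<beta> to \<beta> is invariant.
  So for \<open>a \<le> 2\<close> the critical point cannot escape, and hyperbolicity must come from
  an attracting cycle.\<close>

lemma critical_orbit_bounded:
  assumes "c\<^sup>2 \<le> 2"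
  shows "\<bar>((\<lambda>x. c * (1 - x\<^sup>2)) ^^ n) 0\<bar> \<le> \<beta>"
proof (induction n)
  case (Suc n)
  let ?y = "((\<lambda>x. c * (1 - x\<^sup>2)) ^^ n) 0"
  have "?y\<^sup>2 \<le> \<beta>\<^sup>2" using Suc \<beta> by (metis abs_le_square_iff abs_of_pos)
  then have "c * ?y\<^sup>2 \<le> c * \<beta>\<^sup>2" "0 \<le> c * ?y\<^sup>2" using c by auto
  then have "\<bar>c * (1 - ?y\<^sup>2)\<bar> \<le> \<beta>"
    using \<beta>(2) critical_value_le_fixed_point[OF assms] by (auto simp: algebra_simps)
  then show ?case by simp
qed (use \<beta> in simp)

end

section \<open>Trapped sets for hyperbolic parameters\<close>

lemma quad_map_eq: "quad_map a = (\<lambda>x. sqrt a * (1 - x\<^sup>2))"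
  by (simp add: fun_eq_iff quad_map_def)

lemma quad_map_derivative:
  "(quad_map a has_real_derivative - (2 * sqrt a * x)) (at x)"
  unfolding quad_map_eq by (auto intro!: derivative_eq_intros)

context trapped_quadratic
begin

text \<open>Every step along the cycle gains a factor \<open>rate\<close>, and the weights at its
  start and end cancel because the orbit closes.\<close>

lemma multiplier_gt_1:
  assumes far: "\<And>k. far_from \<delta> E (((\<lambda>x. c * (1 - x\<^sup>2)) ^^ k) p)"
    and n: "0 < n" and p: "((\<lambda>x. c * (1 - x\<^sup>2)) ^^ n) p = p"
  shows "1 < \<bar>\<Prod>k<n. - (2 * c * ((\<lambda>x. c * (1 - x\<^sup>2)) ^^ k) p)\<bar>"
proof -
  let ?f = "\<lambda>x. c * (1 - x\<^sup>2)"
  have r: "1 < rate" using rate_gt_1[OF far] .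
  have step: "rate ^ k * gap_weight E p \<le> \<bar>\<Prod>i<k. - (2 * c * (?f ^^ i) p)\<bar> * gap_weight E ((?f ^^ k) p)" for k
  proof (induction k)
    case (Suc k)
    let ?A = "\<bar>\<Prod>i<k. - (2 * c * (?f ^^ i) p)\<bar>" and ?q = "(?f ^^ k) p"
    have "rate ^ Suc k * gap_weight E p \<le> rate * (?A * gap_weight E ?q)"
      using Suc r by simp
    also have "\<dots> = ?A * (rate * gap_weight E ?q)" by simp
    also have "\<dots> \<le> ?A * (2 * c * \<bar>?q\<bar> * gap_weight E (?f ?q))"
      using gap_weight_expansion[of ?q] far[of k] far[of "Suc k"] by (intro mult_left_mono) auto
    also have "\<dots> = \<bar>\<Prod>i<Suc k. - (2 * c * (?f ^^ i) p)\<bar> * gap_weight E ((?f ^^ Suc k) p)"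
      using c_pos by (simp add: abs_mult)
    finally show ?case .
  qed simp
  have far_p: "far_from \<delta> E p" using far[of 0] by simp
  have "0 < M" using far_abs_less[OF far_p] by linarith
  then have "0 < gap_weight E p"
    using gap_weight_bounds(1)[OF far_p] by (meson divide_pos_pos less_le_trans zero_less_one)
  with step[of n] p have "rate ^ n \<le> \<bar>\<Prod>i<n. - (2 * c * (?f ^^ i) p)\<bar>" by simp
  moreover have "1 < rate ^ n" using r n by (rule one_less_power)
  ultimately show ?thesis by linarith
qed

end

text \<open>For \<open>a > 2\<close> the points of modulus at least \<open>c\<close> suffice as
  \<open>E\<close>, since \<open>Lambda\<close> lies within modulus \<beta>. Otherwise
  \<open>E\<close> also has to carry the critical orbit, which stays away from \<open>Lambda\<close>
  because it lies in the open basin and converges to the cycle.\<close>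

lemma Lambda_trapped:
  assumes a: "0 < a" and hyp: "hyperbolic_quad a"
  shows "\<exists>\<delta> M E. trapped_quadratic (sqrt a) M \<delta> E \<and> (\<forall>x\<in>Lambda (ereal a). far_from \<delta> E x)"
proof -
  define c where "c = sqrt a"
  have c: "0 < c" "c\<^sup>2 = a" using a by (auto simp: c_def)
  obtain \<beta> where \<beta>: "0 < \<beta>" "c * \<beta>\<^sup>2 = \<beta> + c" "1 < c * \<beta>"
    using quadratic_fixed_point[OF c(1)] by metis
  note esc = quadratic_escape[OF c(1) \<beta>] 
  have q: "quad_map a = (\<lambda>x. c * (1 - x\<^sup>2))" by (simp add: quad_map_eq c_def)
  note bdd = bounded_orbit_abs_le[OF c(1) \<beta>, folded q]
  have out: "N \<le> \<bar>c * (1 - x\<^sup>2)\<bar>" if "N \<le> \<bar>x\<bar>" "\<beta> \<le> N" for N x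
  proof -
    have "\<beta> + 2 * (\<bar>x\<bar> - \<beta>) \<le> \<bar>c * (1 - x\<^sup>2)\<bar>" by (rule esc) (use that in auto)
    moreover have "N \<le> \<beta> + 2 * (\<bar>x\<bar> - \<beta>)" using that by simp
    ultimately show ?thesis by (rule order_trans[rotated])
  qed
  show ?thesis
  proof (cases "2 < a")
    case True
    have \<beta>c: "\<beta> < c" using fixed_point_less_critical_value[OF c(1) \<beta>] True c by simp
    have "trapped_quadratic c c (c - \<beta>) {x. c \<le> \<bar>x\<bar>}"
      using out c \<beta>c by unfold_locales auto
    moreover have "far_from (c - \<beta>) {x. c \<le> \<bar>x\<bar>} x" if "x \<in> Lambda (ereal a)" for x
    proof -
      have "\<bar>x\<bar> \<le> \<beta>" using that True bdd[of x] unfolding Lambda_def bounded_orbit_points_def by simp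
      then show ?thesis by (auto simp: far_from_def)
    qed
    ultimately show ?thesis unfolding c_def by blast
  next
    case False
    then have c2: "c\<^sup>2 \<le> 2" using c by simp
    note cb = critical_orbit_bounded[OF c(1) \<beta> c2, folded q]
    have "\<not> filterlim (\<lambda>n. (quad_map a ^^ n) 0) at_infinity sequentially"
    proof
      assume "filterlim (\<lambda>n. (quad_map a ^^ n) 0) at_infinity sequentially"
      then have "\<forall>\<^sub>F n in sequentially. \<beta> + 1 \<le> norm ((quad_map a ^^ n) 0)"
        using \<beta> by (subst (asm) filterlim_at_infinity[of 0]) auto
      then obtain n where "\<beta> + 1 \<le> norm ((quad_map a ^^ n) 0)"
        by (auto simp: eventually_sequentially)
      then show False using cb[of n] by simp
    qed
    then obtain P where attr: "attracting_periodic_orbit (quad_map a) P"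
      using hyp unfolding hyperbolic_quad_def by blast
    note ap = attracting_periodic_orbit_basin[OF attr quad_map_derivative]
    let ?B = "basin (quad_map a) P"
    define E where "E = range (\<lambda>n. (quad_map a ^^ Suc n) 0) \<union> {x. \<beta> + 1 \<le> \<bar>x\<bar>}"
    have trapped: "trapped_quadratic c (\<beta> + 1) \<delta> E" if "0 < \<delta>" for \<delta>
    proof
      show "c \<in> E" unfolding E_def q by (auto intro!: image_eqI[of _ _ 0])
      show "c * (1 - x\<^sup>2) \<in> E" if "x \<in> E" for x
      proof (cases "\<beta> + 1 \<le> \<bar>x\<bar>")
        case True then show ?thesis using out[of "\<beta> + 1" x] by (simp add: E_def)
      next
        case False
        then obtain n where "x = (quad_map a ^^ Suc n) 0" using \<open>x \<in> E\<close> unfolding E_def by blast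
        then have "c * (1 - x\<^sup>2) = (quad_map a ^^ Suc (Suc n)) 0" by (simp add: q)
        then show ?thesis unfolding E_def by blast
      qed
    qed (use c that in \<open>auto simp: E_def\<close>)
    have farI: "far_from \<delta> E x"
      if "\<delta> \<le> 1" "\<bar>x\<bar> \<le> \<beta>" "\<And>n. \<delta> \<le> \<bar>x - (quad_map a ^^ Suc n) 0\<bar>" for x \<delta>
      using that by (auto simp: far_from_def E_def)
    obtain e where e: "0 < e" "(\<Union>p\<in>P. ball p e) \<subseteq> ?B"
      using compact_subset_open_imp_ball_epsilon_subset[OF finite_imp_compact[OF ap(1)] ap(6,5)] by blast
    obtain p n where p: "p \<in> P" "0 < n" "(quad_map a ^^ n) p = p"
      and mult: "\<bar>\<Prod>k<n. - (2 * sqrt a * (quad_map a ^^ k) p)\<bar> < 1" using ap(4) by blast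
    have orbP: "(quad_map a ^^ k) p \<in> P" for k
      using ap(3) p(1) by (induction k) auto
    have orbb: "\<bar>(quad_map a ^^ k) p\<bar> \<le> \<beta>" for k
    proof -
      have "range (\<lambda>n. (quad_map a ^^ n) ((quad_map a ^^ k) p)) \<subseteq> P"
        using orbP by (auto simp flip: comp_apply[of "_ ^^ _"] funpow_add)
      then show ?thesis
        using bdd[of "(quad_map a ^^ k) p"] ap(1)
        by (meson bounded_subset finite_imp_bounded)
    qed
    text \<open>Singer's theorem: a critical orbit outside the basin would make the attracting orbit expanding.\<close>
    have zero: "0 \<in> ?B"
    proof (rule ccontr)
      assume "0 \<notin> ?B"
      then have n0: "(quad_map a ^^ k) 0 \<notin> ?B" for k by (simp add: funpow_in_basin_iff)
      \<comment> \<open>\<open>e\<close> separates the cycle from the critical orbit, assumed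
        outside the basin; 1 separates it from the points of modulus at least
        \<open>\<beta> + 1\<close>.\<close>
      define \<delta> where "\<delta> = min e 1"
      have \<delta>: "0 < \<delta>" "\<delta> \<le> 1" "\<delta> \<le> e" using e by (auto simp: \<delta>_def)
      interpret trapped_quadratic c "\<beta> + 1" \<delta> E by (rule trapped[OF \<delta>(1)])
      have "far_from \<delta> E ((quad_map a ^^ k) p)" for k
      proof (rule farI[OF \<delta>(2) orbb])
        fix j
        have "(quad_map a ^^ Suc j) 0 \<notin> ball ((quad_map a ^^ k) p) e"
          using e(2) orbP n0 by blast
        then show "\<delta> \<le> \<bar>(quad_map a ^^ k) p - (quad_map a ^^ Suc j) 0\<bar>"
          using \<delta>(3) by (simp add: dist_real_def)
      qed
      then have "1 < \<bar>\<Prod>k<n. - (2 * c * (quad_map a ^^ k) p)\<bar>"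
        using multiplier_gt_1[folded q] p by blast
      then show False using mult by (simp add: c_def)
    qed
    then have lim: "(\<lambda>n. infdist ((quad_map a ^^ n) 0) P) \<longlonglongrightarrow> 0" by (simp add: basin_def)
    \<comment> \<open>The critical orbit splits into a tail near \<open>P\<close> and a finite
      initial piece \<open>Z\<close> with its own radius \<open>e'\<close>. A tail point is within
      \<open>e / 2\<close> of some point of \<open>P\<close>, while points outside the basin are at
      least \<open>e\<close> away from it; this leaves a distance of \<open>e / 2\<close>.\<close>
    obtain N where N: "\<And>n. N \<le> n \<Longrightarrow> infdist ((quad_map a ^^ n) 0) P < e / 2"
      using order_tendstoD(2)[OF lim, of "e / 2"] e by (auto simp: eventually_sequentially)
    define Z where "Z = (\<lambda>n. (quad_map a ^^ n) 0) ` {..<N}"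
    have "Z \<subseteq> ?B" using zero by (auto simp: Z_def funpow_in_basin_iff)
    moreover have "compact Z" by (simp add: Z_def finite_imp_compact)
    ultimately obtain e' where e': "0 < e'" "(\<Union>z\<in>Z. ball z e') \<subseteq> ?B"
      using compact_subset_open_imp_ball_epsilon_subset[OF _ ap(6)] by metis
    define \<delta> where "\<delta> = min 1 (min (e / 2) e')"
    have \<delta>: "0 < \<delta>" "\<delta> \<le> 1" "\<delta> \<le> e / 2" "\<delta> \<le> e'" using e e' by (auto simp: \<delta>_def)
    have "far_from \<delta> E x" if x: "x \<in> Lambda (ereal a)" for x
    proof (rule farI[OF \<delta>(2)])
      have bo: "x \<in> bounded_orbit_points a" and nB: "x \<notin> ?B"
        using x False attr unfolding Lambda_def by auto
      show "\<bar>x\<bar> \<le> \<beta>" using bdd[of x] bo by (simp add: bounded_orbit_points_def)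
      fix n
      let ?z = "(quad_map a ^^ Suc n) 0"
      show "\<delta> \<le> \<bar>x - ?z\<bar>"
      proof (cases "Suc n < N")
        case True
        then have "?z \<in> Z" unfolding Z_def by blast
        then have "x \<notin> ball ?z e'" using e'(2) nB by blast
        then show ?thesis using \<delta>(4) by (simp add: dist_real_def abs_minus_commute)
      next
        case False
        then have "infdist ?z P < e / 2" by (intro N) simp
        moreover obtain p' where p': "p' \<in> P" "infdist ?z P = dist ?z p'"
          using infdist_attains_inf[OF compact_imp_closed[OF finite_imp_compact[OF ap(1)]] ap(2)] by metis
        moreover have "x \<notin> ball p' e" using e(2) nB p'(1) by blast
        ultimately have "\<bar>?z - p'\<bar> < e / 2" "e \<le> \<bar>p' - x\<bar>" by (simp_all add: dist_real_def)
        then show ?thesis using \<delta>(3) by linarith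
      qed
    qed
    then show ?thesis using trapped[OF \<delta>(1)] unfolding c_def by blast
  qed
qed

lemma Lambda_forward_invariant:
  assumes "0 < a" "x \<in> Lambda (ereal a)"
  shows "quad_map a x \<in> Lambda (ereal a)"
proof -
  have b: "quad_map a x \<in> bounded_orbit_points a" if "x \<in> bounded_orbit_points a"
  proof -
    have eq: "(quad_map a ^^ n) (quad_map a x) = (quad_map a ^^ Suc n) x" for n
      by (simp add: funpow_swap1)
    have "range (\<lambda>n. (quad_map a ^^ n) (quad_map a x)) \<subseteq> range (\<lambda>n. (quad_map a ^^ n) x)"
      unfolding eq by blast
    then show ?thesis using that bounded_subset unfolding bounded_orbit_points_def by blast
  qed
  have "quad_map a x \<in> basin (quad_map a) P \<longleftrightarrow> x \<in> basin (quad_map a) P" for P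
    using funpow_in_basin_iff[of 1 "quad_map a"] by simp
  then show ?thesis using assms(2) b unfolding Lambda_def by (auto simp: Let_def split: if_splits)
qed

text \<open>The limit equation reads \<open>rhat * x (i - 1) = 1 - (x i)\<^sup>2\<close>, so \<open>x\<close>, or \<open>- x\<close> if
  \<open>rhat < 0\<close>, is a backward orbit of the quadratic map with parameter \<open>1 / rhat\<^sup>2\<close>. The weights
  \<open>w\<close> form an adapted norm in which it expands at every step.\<close>

lemma limit_sol_set_adapted_weights:
  assumes "1 / ereal (rhat\<^sup>2) \<in> Hyp" "r 0 = rhat"
  shows "\<exists>m M \<kappa> c1 c2. 0 < m \<and> 0 < M \<and> 0 \<le> \<kappa> \<and> \<kappa> < 1 \<and> 0 < c1 \<and> 0 < c2 \<and>
    (\<forall>x\<in>limit_sol_set r rhat. (\<forall>i. m \<le> \<bar>x i\<bar> \<and> \<bar>x i\<bar> \<le> M) \<and>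
      (\<exists>w. \<forall>i. c1 \<le> w i \<and> w i \<le> c2 \<and> \<bar>rhat\<bar> * w i \<le> \<kappa> * (2 * \<bar>x i\<bar> * w (i - 1))))"
proof (cases "rhat = 0")
  case True
  then have inf: "1 / ereal (rhat\<^sup>2) = \<infinity>" by (simp add: zero_ereal_def[symmetric])
  have x: "\<bar>x i\<bar> = 1" if "x \<in> limit_sol_set r rhat" for x i
  proof -
    have "x i \<in> {-1, 1}" using that inf by (simp add: limit_sol_set_def Lambda_def)
    then show ?thesis by auto
  qed
  \<comment> \<open>All entries are 1 or -1, and with \<open>rhat = 0\<close> the weight inequality
    has left side 0, so constant weights and \<open>\<kappa> = 0\<close> work.\<close>
  show ?thesis
    by (rule exI[of _ 1], rule exI[of _ 1], rule exI[of _ 0], rule exI[of _ 1], rule exI[of _ 1])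
      (use True x in \<open>auto intro: exI[of _ "\<lambda>_. 1"]\<close>)
next
  case False
  define a where "a = 1 / rhat\<^sup>2"
  have a: "0 < a" using False by (simp add: a_def)
  have ea: "1 / ereal (rhat\<^sup>2) = ereal a" using False by (simp add: a_def one_ereal_def)
  have sa: "sqrt a = 1 / \<bar>rhat\<bar>" by (simp add: a_def real_sqrt_divide)
  have "hyperbolic_quad a" using assms(1) unfolding ea Hyp_def by auto
  from Lambda_trapped[OF a this] obtain \<delta> M E
    where tq: "trapped_quadratic (sqrt a) M \<delta> E" and far: "\<And>x. x \<in> Lambda (ereal a) \<Longrightarrow> far_from \<delta> E x"
    by blast
  interpret trapped_quadratic "sqrt a" M \<delta> E by (rule tq)
  \<comment> \<open>A limit solution is needed to know that \<open>1 < rate\<close> and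
    \<open>0 < M\<close>; without one the claim is vacuous.\<close>
  show ?thesis
  proof (cases "limit_sol_set r rhat = {}")
    case True
    show ?thesis
      by (rule exI[of _ 1], rule exI[of _ 1], rule exI[of _ 0], rule exI[of _ 1], rule exI[of _ 1])
        (simp add: True)
  next
    case False
    then obtain x0 where "x0 \<in> limit_sol_set r rhat" by blast
    then have "x0 0 \<in> Lambda (ereal a)" by (simp add: limit_sol_set_def ea)
    from far[OF this] have r: "1 < rate" and M: "0 < M"
      using rate_gt_1 far_abs_less abs_ge_zero le_less_trans by blast+
    define m where "m = sqrt (\<delta> / sqrt a)"
    have m: "0 < m" using delta_pos a by (simp add: m_def)
    have main: "(\<forall>i. m \<le> \<bar>x i\<bar> \<and> \<bar>x i\<bar> \<le> M) \<and>
      (\<exists>w. \<forall>i. 1 / M \<le> w i \<and> w i \<le> 2 / \<delta> \<and> \<bar>rhat\<bar> * w i \<le> 1 / rate * (2 * \<bar>x i\<bar> * w (i - 1)))"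
      if x: "x \<in> limit_sol_set r rhat" for x
    proof -
      have L: "x i \<in> Lambda (ereal a)" for i using x by (simp add: limit_sol_set_def ea)
      have "rhat * x (i - 1) = 1 - (x i)\<^sup>2" for i
        using x assms(2) by (simp add: limit_sol_set_def F_def algebra_simps)
      then have eq: "quad_map a (x i) = sgn rhat * x (i - 1)" for i
        using \<open>rhat \<noteq> 0\<close> by (simp add: quad_map_def sa field_simps sgn_if split: if_splits)
      \<comment> \<open>Since \<open>sqrt a\<close> is the reciprocal of the modulus of
        \<open>rhat\<close>, the sign is lost; restoring it turns \<open>x\<close> into a genuine
        backward orbit \<open>y\<close>. Its entries are in \<open>Lambda\<close> because they are
        images of entries of \<open>x\<close>.\<close>
      define y where "y = (\<lambda>i. sgn rhat * x i)"
      have yq: "y (i - 1) = quad_map a (x i)" for i using eq by (simp add: y_def)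
      have "y i \<in> Lambda (ereal a)" for i
        using yq[of "i + 1"] Lambda_forward_invariant[OF a L] by simp
      then have fy: "far_from \<delta> E (y i)" for i by (rule far)
      have y2: "(y i)\<^sup>2 = (x i)\<^sup>2" and yabs: "\<bar>y i\<bar> = \<bar>x i\<bar>" for i
        using \<open>rhat \<noteq> 0\<close> by (auto simp: y_def power_mult_distrib sgn_if abs_mult)
      have yy: "sqrt a * (1 - (y i)\<^sup>2) = y (i - 1)" for i by (simp add: yq quad_map_def y2)
      have "m \<le> \<bar>x i\<bar>" for i
        using far_value[of "x i"] fy[of "i - 1"] yy[of i] real_sqrt_le_mono unfolding m_def y2
        by (metis real_sqrt_abs)
      moreover have "\<bar>x i\<bar> \<le> M" for i using far_abs_less[OF far[OF L, of i]] by simp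
      moreover have "\<bar>rhat\<bar> * gap_weight E (y i) \<le> 1 / rate * (2 * \<bar>x i\<bar> * gap_weight E (y (i - 1)))" for i
      proof -
        have "rate * gap_weight E (y i) \<le> 2 * sqrt a * \<bar>y i\<bar> * gap_weight E (y (i - 1))"
          using gap_weight_expansion[of "y i"] fy yy by simp
        then show ?thesis using r \<open>rhat \<noteq> 0\<close> by (simp add: sa yabs field_simps)
      qed
      ultimately show ?thesis
        using gap_weight_bounds[OF fy] by (intro conjI allI exI[of _ "\<lambda>i. gap_weight E (y i)"]) auto
    qed
    show ?thesis
      by (rule exI[of _ m], rule exI[of _ M], rule exI[of _ "1 / rate"], rule exI[of _ "1 / M"],
          rule exI[of _ "2 / \<delta>"]) (use main m M r delta_pos in auto)
  qed
qed

section \<open>Continuation from the limit equation\<close>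

text \<open>Stating the contraction for every bound \<open>d\<close> lets it be iterated from
  \<open>B\<close> without forming a supremum.\<close>

lemma sup_contraction_eq_zero:
  fixes g :: "'i \<Rightarrow> real"
  assumes "\<And>i. \<bar>g i\<bar> \<le> B" "0 \<le> \<theta>" "\<theta> < 1"
    and contr: "\<And>d i. (\<And>j. \<bar>g j\<bar> \<le> d) \<Longrightarrow> \<bar>g i\<bar> \<le> \<theta> * d"
  shows "g i = 0"
proof -
  have "\<bar>g i\<bar> \<le> \<theta> ^ n * B" for n i
  proof (induction n arbitrary: i)
    case (Suc n)
    show ?case using contr[OF Suc] by (simp add: mult.assoc)
  qed (simp add: assms(1))
  moreover have "(\<lambda>n. \<theta> ^ n * B) \<longlonglongrightarrow> 0"
    using assms(2,3) by (intro tendsto_mult_left_zero LIMSEQ_power_zero) auto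
  ultimately have "\<bar>g i\<bar> \<le> 0" by (intro LIMSEQ_le_const[of "\<lambda>n. \<theta> ^ n * B"]) auto
  then show ?thesis by simp
qed

text \<open>Banach's fixed point theorem on a ball in a weighted sup norm, with the norm replaced by
  coordinatewise bounds. The iterates of 0 converge in each coordinate, and estimates uniform in the
  coordinate pass to the limit.\<close>

lemma weighted_sup_contraction_fixed_point:
  fixes G :: "('i \<Rightarrow> real) \<Rightarrow> 'i \<Rightarrow> real"
  assumes w: "\<And>i. 0 < w i" and \<theta>: "0 \<le> \<theta>" "\<theta> < 1" and B: "0 \<le> B"
    and maps: "\<And>u i. (\<And>j. w j * \<bar>u j\<bar> \<le> B) \<Longrightarrow> w i * \<bar>G u i\<bar> \<le> B"
    and contr: "\<And>u v d i. (\<And>j. w j * \<bar>u j\<bar> \<le> B) \<Longrightarrow> (\<And>j. w j * \<bar>v j\<bar> \<le> B) \<Longrightarrow>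
      (\<And>j. w j * \<bar>u j - v j\<bar> \<le> d) \<Longrightarrow> w i * \<bar>G u i - G v i\<bar> \<le> \<theta> * d"
  shows "\<exists>u. (\<forall>i. w i * \<bar>u i\<bar> \<le> B) \<and> G u = u"
proof -
  define u where "u n = (G ^^ n) (\<lambda>_. 0)" for n
  have u_simps: "u 0 = (\<lambda>_. 0)" "u (Suc n) = G (u n)" for n by (simp_all add: u_def)
  have ub: "w i * \<bar>u n i\<bar> \<le> B" for n i
  proof (induction n arbitrary: i)
    case 0
    then show ?case using B by (simp add: u_simps)
  next
    case (Suc n)
    then show ?case using maps[of "u n"] by (simp add: u_simps)
  qed
  \<comment> \<open>Comparing with all later iterates at once avoids a geometric series: for
    \<open>n = 0\<close> the bound is membership in the ball.\<close>
  have diff: "w i * \<bar>u (n + k) i - u n i\<bar> \<le> \<theta> ^ n * B" for n k i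
  proof (induction n arbitrary: i)
    case 0
    then show ?case using ub[of i k] by (simp add: u_simps)
  next
    case (Suc n)
    then show ?case using contr[OF ub ub Suc] by (simp add: u_simps mult.assoc)
  qed
  have lim: "(\<lambda>n. \<theta> ^ n * C) \<longlonglongrightarrow> 0" for C
    using \<theta> by (intro tendsto_mult_left_zero LIMSEQ_power_zero) auto
  have "\<exists>l. (\<lambda>n. u n i) \<longlonglongrightarrow> l" for i
  proof -
    have "Cauchy (\<lambda>n. u n i)"
    proof (rule metric_CauchyI)
      fix e :: real assume "0 < e"
      then have "\<forall>\<^sub>F n in sequentially. \<theta> ^ n * B < w i * (e / 2)"
        using w[of i] by (intro order_tendstoD(2)[OF lim]) simp
      then obtain N where N: "\<theta> ^ N * B < w i * (e / 2)" by (auto simp: eventually_sequentially)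
      have near: "\<bar>u n i - u N i\<bar> < e / 2" if "N \<le> n" for n
      proof -
        have "w i * \<bar>u n i - u N i\<bar> < w i * (e / 2)"
          using diff[of i N "n - N"] N that by simp
        then show ?thesis using w[of i] by (simp only: mult_less_cancel_left_pos)
      qed
      have "dist (u n i) (u n' i) < e" if "N \<le> n" "N \<le> n'" for n n'
        using near[OF that(1)] near[OF that(2)] unfolding dist_real_def by linarith
      then show "\<exists>N. \<forall>n\<ge>N. \<forall>n'\<ge>N. dist (u n i) (u n' i) < e" by blast
    qed
    then show ?thesis by (simp add: Cauchy_convergent_iff convergent_def)
  qed
  then obtain L where L: "\<And>i. (\<lambda>n. u n i) \<longlonglongrightarrow> L i" by metis
  have Ld: "w i * \<bar>L i - u n i\<bar> \<le> \<theta> ^ n * B" for n i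
  proof (rule LIMSEQ_le_const2)
    show "(\<lambda>k. w i * \<bar>u (k + n) i - u n i\<bar>) \<longlonglongrightarrow> w i * \<bar>L i - u n i\<bar>"
      by (intro tendsto_intros LIMSEQ_ignore_initial_segment L)
    show "\<exists>N. \<forall>k\<ge>N. w i * \<bar>u (k + n) i - u n i\<bar> \<le> \<theta> ^ n * B"
      using diff[of i n] by (auto simp: add.commute)
  qed
  have Lb: "w i * \<bar>L i\<bar> \<le> B" for i using Ld[of i 0] by (simp add: u_simps)
  have "G L i = L i" for i
  proof -
    have "w i * \<bar>G L i - L i\<bar> \<le> \<theta> ^ n * (2 * \<theta> * B)" for n
    proof -
      have "\<bar>G L i - L i\<bar> \<le> \<bar>G L i - G (u n) i\<bar> + \<bar>L i - u (Suc n) i\<bar>" by (simp add: u_simps)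
      then have "w i * \<bar>G L i - L i\<bar> \<le> w i * \<bar>G L i - G (u n) i\<bar> + w i * \<bar>L i - u (Suc n) i\<bar>"
        using mult_left_mono[of _ _ "w i"] w[of i] by (fastforce simp flip: distrib_left)
      also have "\<dots> \<le> \<theta> * (\<theta> ^ n * B) + \<theta> ^ Suc n * B"
        by (intro add_mono contr Lb ub Ld)
      finally show ?thesis by (simp add: mult_ac)
    qed
    then have "w i * \<bar>G L i - L i\<bar> \<le> 0"
      by (intro LIMSEQ_le_const[OF lim]) blast
    then show ?thesis using w[of i] by (simp add: mult_le_0_iff)
  qed
  then show ?thesis using Lb by blast
qed

text \<open>One limit solution and one \<epsilon> are fixed. \<open>small\<close> makes the equation
  for the deviation a contraction with factor \<theta>, and \<open>defect\<close> makes it preserve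
  the ball of weighted radius \<open>c1 * \<delta> / 2\<close>. Both involve only constants that can
  be chosen uniformly over all limit solutions.\<close>

locale adapted_limit_solution =
  fixes r :: "real \<Rightarrow> real" and rhat m M \<kappa> c1 c2 \<delta> \<theta> \<epsilon> :: real and xd w :: "int \<Rightarrow> real"
  assumes pos: "0 < m" "0 < M" "0 \<le> \<kappa>" "0 < c1" "0 < c2" "0 < \<delta>" "0 \<le> \<epsilon>"
    and xd_bounds: "\<And>i. m \<le> \<bar>xd i\<bar>" "\<And>i. \<bar>xd i\<bar> \<le> M"
    and w_bounds: "\<And>i. c1 \<le> w i" "\<And>i. w i \<le> c2"
    and w_contr: "\<And>i. \<bar>rhat\<bar> * w i \<le> \<kappa> * (2 * \<bar>xd i\<bar> * w (i - 1))"
    and limit_eq: "\<And>i. rhat * xd (i - 1) = 1 - (xd i)\<^sup>2"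
    and small: "\<kappa> + c2 / (2 * m * c1) * (2 * \<delta> + \<bar>r \<epsilon> - rhat\<bar> + \<epsilon>) \<le> \<theta>" "\<theta> < 1"
    and defect: "c2 / (2 * m) * ((\<bar>r \<epsilon> - rhat\<bar> + \<epsilon>) * M) \<le> (1 - \<theta>) * (c1 * \<delta> / 2)"
begin

abbreviation "\<sigma> \<equiv> \<bar>r \<epsilon> - rhat\<bar>"

lemma w_pos: "0 < w i"
  using w_bounds(1)[of i] pos by linarith

lemma le_of_weighted: "w i * \<bar>a\<bar> \<le> d \<Longrightarrow> \<bar>a\<bar> \<le> d / c1"
  using mult_right_mono[OF w_bounds(1)[of i], of "\<bar>a\<bar>"] pos by (simp add: pos_le_divide_eq mult.commute)

text \<open>The common estimate behind existence, uniqueness and the trivial kernel. The term with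
  \<open>rhat\<close> need not be small, but \<open>w_contr\<close> gives it the factor \<kappa>;
  the other linear terms are small even after the loss \<open>c2 / c1\<close> from changing norms.
  The inhomogeneity is \<eta>.\<close>

lemma weighted_estimate:
  assumes q: "\<bar>2 * xd i * q\<bar> \<le> \<bar>rhat\<bar> * \<bar>g (i - 1)\<bar> + \<alpha> * \<bar>g i\<bar> + \<sigma> * \<bar>g (i - 1)\<bar> + \<epsilon> * \<bar>g (i + 1)\<bar> + \<eta>"
    and g: "\<And>j. w j * \<bar>g j\<bar> \<le> d" and \<alpha>: "0 \<le> \<alpha>" "\<alpha> \<le> 2 * \<delta>" and \<eta>: "0 \<le> \<eta>"
  shows "w i * \<bar>q\<bar> \<le> \<theta> * d + c2 / (2 * m) * \<eta>"
proof -
  have d0: "0 \<le> d" using g[of i] w_pos[of i] by (smt (verit) abs_ge_zero mult_nonneg_nonneg)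
  have gb: "\<bar>g j\<bar> \<le> d / c1" for j by (rule le_of_weighted[OF g])
  define X where "X = c2 * ((\<alpha> + \<sigma> + \<epsilon>) * (d / c1) + \<eta>)"
  have X0: "0 \<le> X" using pos \<alpha> \<eta> d0 by (simp add: X_def)
  have xi: "0 < \<bar>xd i\<bar>" using xd_bounds(1)[of i] pos by linarith
  have "w i * (\<alpha> * \<bar>g i\<bar> + \<sigma> * \<bar>g (i - 1)\<bar> + \<epsilon> * \<bar>g (i + 1)\<bar> + \<eta>) \<le> X"
    unfolding X_def
  proof (rule mult_mono)
    have "\<alpha> * \<bar>g i\<bar> \<le> \<alpha> * (d / c1)" "\<sigma> * \<bar>g (i - 1)\<bar> \<le> \<sigma> * (d / c1)" "\<epsilon> * \<bar>g (i + 1)\<bar> \<le> \<epsilon> * (d / c1)"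
      using \<alpha> pos by (intro mult_left_mono gb; simp)+
    then show "\<alpha> * \<bar>g i\<bar> + \<sigma> * \<bar>g (i - 1)\<bar> + \<epsilon> * \<bar>g (i + 1)\<bar> + \<eta> \<le> (\<alpha> + \<sigma> + \<epsilon>) * (d / c1) + \<eta>"
      unfolding distrib_right by linarith
  qed (use w_bounds pos \<alpha> \<eta> in auto)
  \<comment> \<open>Here the expansion enters: the weight at \<open>i\<close> is traded for the
    weight at \<open>i - 1\<close>, which matches the index of \<open>g\<close>.\<close>
  moreover have "\<bar>rhat\<bar> * w i * \<bar>g (i - 1)\<bar> \<le> \<kappa> * (2 * \<bar>xd i\<bar> * w (i - 1)) * \<bar>g (i - 1)\<bar>"
    using w_contr by (intro mult_right_mono) auto
  moreover have "\<kappa> * (2 * \<bar>xd i\<bar>) * (w (i - 1) * \<bar>g (i - 1)\<bar>) \<le> \<kappa> * (2 * \<bar>xd i\<bar>) * d"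
    using g pos by (intro mult_left_mono) auto
  moreover have "w i * \<bar>2 * xd i * q\<bar> \<le>
      w i * (\<bar>rhat\<bar> * \<bar>g (i - 1)\<bar> + (\<alpha> * \<bar>g i\<bar> + \<sigma> * \<bar>g (i - 1)\<bar> + \<epsilon> * \<bar>g (i + 1)\<bar> + \<eta>))"
    using q w_pos[of i] by (intro mult_left_mono) auto
  ultimately have "2 * \<bar>xd i\<bar> * (w i * \<bar>q\<bar>) \<le> 2 * \<bar>xd i\<bar> * (\<kappa> * d) + X"
    by (simp add: abs_mult distrib_left mult_ac)
  then have "w i * \<bar>q\<bar> \<le> \<kappa> * d + X / (2 * \<bar>xd i\<bar>)"
    using xi by (simp add: field_simps)
  also have "X / (2 * \<bar>xd i\<bar>) \<le> X / (2 * m)"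
    using X0 xd_bounds(1)[of i] pos by (intro divide_left_mono) auto
  also have "\<kappa> * d + X / (2 * m) = (\<kappa> + c2 / (2 * m * c1) * (\<alpha> + \<sigma> + \<epsilon>)) * d + c2 / (2 * m) * \<eta>"
    using pos by (simp add: X_def field_simps)
  also have "\<dots> \<le> \<theta> * d + c2 / (2 * m) * \<eta>"
  proof -
    have "c2 / (2 * m * c1) * (\<alpha> + \<sigma> + \<epsilon>) \<le> c2 / (2 * m * c1) * (2 * \<delta> + \<sigma> + \<epsilon>)"
      using \<alpha> pos by (intro mult_left_mono) auto
    then have "\<kappa> + c2 / (2 * m * c1) * (\<alpha> + \<sigma> + \<epsilon>) \<le> \<theta>" using small(1) by linarith
    then show ?thesis using d0 by (intro add_right_mono mult_right_mono) auto
  qed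
  finally show ?thesis by simp
qed

lemma theta_nonneg: "0 \<le> \<theta>"
proof -
  have "0 \<le> c2 / (2 * m * c1) * (2 * \<delta> + \<sigma> + \<epsilon>)" using pos by (intro mult_nonneg_nonneg) auto
  then show ?thesis using small pos by linarith
qed

text \<open>The free coefficient \<open>s\<close> serves two purposes: it is \<open>x + y\<close>
  for the difference of two solutions, and twice the continued solution for the variational
  equation.\<close>

lemma bounded_kernel_trivial:
  assumes bd: "bounded (range p)" and s: "\<And>i. \<bar>s i - 2 * xd i\<bar> \<le> 2 * \<delta>"
    and eq: "\<And>i. \<epsilon> * p (i + 1) + s i * p i + r \<epsilon> * p (i - 1) = 0"
  shows "p i = 0"
proof -
  obtain B where B: "\<And>i. \<bar>p i\<bar> \<le> B" using bd by (auto simp: bounded_iff)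
  have "w i * p i = 0"
  proof (rule sup_contraction_eq_zero[where g = "\<lambda>i. w i * p i" and i = i, OF _ theta_nonneg small(2)])
    show "\<bar>w i * p i\<bar> \<le> c2 * B" for i
      unfolding abs_mult using w_bounds(2) w_pos[of i] B pos by (intro mult_mono) auto
    fix d i assume d: "\<And>j. \<bar>w j * p j\<bar> \<le> d"
    have wp: "\<bar>w j * p j\<bar> = w j * \<bar>p j\<bar>" for j using w_pos[of j] by (simp add: abs_mult)
    have "2 * xd i * p i =
        - (rhat * p (i - 1) + (s i - 2 * xd i) * p i + (r \<epsilon> - rhat) * p (i - 1) + \<epsilon> * p (i + 1))"
      using eq[of i] by (simp add: algebra_simps)
    then have "\<bar>2 * xd i * p i\<bar> \<le>
        \<bar>rhat * p (i - 1)\<bar> + \<bar>(s i - 2 * xd i) * p i\<bar> + \<bar>(r \<epsilon> - rhat) * p (i - 1)\<bar> + \<bar>\<epsilon> * p (i + 1)\<bar>"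
      by linarith
    also have "\<dots> \<le> \<bar>rhat\<bar> * \<bar>p (i - 1)\<bar> + 2 * \<delta> * \<bar>p i\<bar> + \<sigma> * \<bar>p (i - 1)\<bar> + \<epsilon> * \<bar>p (i + 1)\<bar> + 0"
      using mult_right_mono[OF s[of i], of "\<bar>p i\<bar>"] pos by (simp add: abs_mult)
    finally have "w i * \<bar>p i\<bar> \<le> \<theta> * d + c2 / (2 * m) * 0"
      by (rule weighted_estimate) (use d pos in \<open>auto simp: wp\<close>)
    then show "\<bar>w i * p i\<bar> \<le> \<theta> * d" by (simp add: wp)
  qed
  then show ?thesis using w_pos[of i] by simp
qed

lemma solution_unique:
  assumes x: "x \<in> sol_set r \<epsilon>" "\<And>i. \<bar>x i - xd i\<bar> < \<delta>"
    and y: "y \<in> sol_set r \<epsilon>" "\<And>i. \<bar>y i - xd i\<bar> < \<delta>"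
  shows "x = y"
proof
  fix i
  have "x i - y i = 0"
  proof (rule bounded_kernel_trivial[of "\<lambda>i. x i - y i" "\<lambda>i. x i + y i"])
    have "\<bar>x j - y j\<bar> \<le> 2 * \<delta>" "\<bar>x j + y j - 2 * xd j\<bar> \<le> 2 * \<delta>" for j
      using x(2)[of j] y(2)[of j] by linarith+
    then show "bounded (range (\<lambda>i. x i - y i))" "\<And>i. \<bar>x i + y i - 2 * xd i\<bar> \<le> 2 * \<delta>"
      by (auto simp: bounded_iff)
    show "\<epsilon> * (x (j + 1) - y (j + 1)) + (x j + y j) * (x j - y j) + r \<epsilon> * (x (j - 1) - y (j - 1)) = 0" for j
    proof -
      have "F r x \<epsilon> j - F r y \<epsilon> j = 0" using x(1) y(1) by (simp add: sol_set_def)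
      then show ?thesis by (simp add: F_def algebra_simps power2_eq_square)
    qed
  qed
  then show "x i = y i" by simp
qed

lemma solution_exists: "\<exists>x. x \<in> sol_set r \<epsilon> \<and> (\<forall>i. \<bar>x i - xd i\<bar> < \<delta>)"
proof -
  \<comment> \<open>Subtract the limit equation from \<open>F = 0\<close> at \<open>xd + h\<close>
    and solve for the linear term \<open>2 * xd i * h i\<close>; fixed points of \<open>G\<close>
    are the deviations sought.\<close>
  define G where "G h i = - (rhat * h (i - 1) + (h i)\<^sup>2 + (r \<epsilon> - rhat) * (xd (i - 1) + h (i - 1))
    + \<epsilon> * (xd (i + 1) + h (i + 1))) / (2 * xd i)" for h :: "int \<Rightarrow> real" and i
  have xi: "xd i \<noteq> 0" for i using xd_bounds(1)[of i] pos by auto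
  have G: "2 * xd i * G h i = - (rhat * h (i - 1) + (h i)\<^sup>2 + (r \<epsilon> - rhat) * (xd (i - 1) + h (i - 1))
    + \<epsilon> * (xd (i + 1) + h (i + 1)))" for h i using xi[of i] by (simp add: G_def)
  \<comment> \<open>This radius gives deviations of at most \<open>\<delta> / 2\<close>: strictly
    below \<delta>, and with sums of two of them bounded by \<delta> in the contraction
    estimate.\<close>
  define B where "B = c1 * \<delta> / 2"
  have B: "0 \<le> B" "B / c1 = \<delta> / 2" using pos by (simp_all add: B_def)
  have hb: "\<bar>h j\<bar> \<le> \<delta> / 2" if "\<And>j. w j * \<bar>h j\<bar> \<le> B" for h :: "int \<Rightarrow> real" and j
    using le_of_weighted[OF that] B by simp
  have "\<exists>h. (\<forall>i. w i * \<bar>h i\<bar> \<le> B) \<and> G h = h"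
  proof (rule weighted_sup_contraction_fixed_point[where w = w, OF w_pos theta_nonneg small(2) B(1)])
    fix h :: "int \<Rightarrow> real" and i
    assume h: "\<And>j. w j * \<bar>h j\<bar> \<le> B"
    have "\<bar>2 * xd i * G h i\<bar> \<le> \<bar>rhat * h (i - 1)\<bar> + \<bar>h i * h i\<bar> + \<bar>(r \<epsilon> - rhat) * h (i - 1)\<bar>
        + \<bar>\<epsilon> * h (i + 1)\<bar> + (\<bar>(r \<epsilon> - rhat) * xd (i - 1)\<bar> + \<bar>\<epsilon> * xd (i + 1)\<bar>)"
      unfolding G power2_eq_square distrib_left by linarith
    also have "\<dots> \<le> \<bar>rhat\<bar> * \<bar>h (i - 1)\<bar> + \<delta> / 2 * \<bar>h i\<bar> + \<sigma> * \<bar>h (i - 1)\<bar> + \<epsilon> * \<bar>h (i + 1)\<bar> + (\<sigma> + \<epsilon>) * M"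
    proof -
      have "\<bar>h i * h i\<bar> \<le> \<delta> / 2 * \<bar>h i\<bar>"
        unfolding abs_mult using hb[OF h] by (intro mult_right_mono) auto
      moreover have "\<bar>(r \<epsilon> - rhat) * xd (i - 1)\<bar> \<le> \<sigma> * M" "\<bar>\<epsilon> * xd (i + 1)\<bar> \<le> \<epsilon> * M"
        unfolding abs_mult using xd_bounds(2) pos by (auto intro!: mult_mono)
      moreover have "\<bar>\<epsilon> * h (i + 1)\<bar> = \<epsilon> * \<bar>h (i + 1)\<bar>" using pos by (simp add: abs_mult)
      ultimately show ?thesis unfolding abs_mult distrib_right by linarith
    qed
    finally have "w i * \<bar>G h i\<bar> \<le> \<theta> * B + c2 / (2 * m) * ((\<sigma> + \<epsilon>) * M)"
      by (rule weighted_estimate) (use h pos in auto)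
    also have "\<dots> \<le> \<theta> * B + (1 - \<theta>) * B" using defect by (simp add: B_def)
    finally show "w i * \<bar>G h i\<bar> \<le> B" by (simp add: algebra_simps)
  next
    fix h k :: "int \<Rightarrow> real" and d i
    assume h: "\<And>j. w j * \<bar>h j\<bar> \<le> B" and k: "\<And>j. w j * \<bar>k j\<bar> \<le> B"
      and d: "\<And>j. w j * \<bar>h j - k j\<bar> \<le> d"
    have "2 * xd i * (G h i - G k i) = 2 * xd i * G h i - 2 * xd i * G k i"
      by (simp add: right_diff_distrib)
    also have "\<dots> = - (rhat * (h (i - 1) - k (i - 1)) + (h i + k i) * (h i - k i)
        + (r \<epsilon> - rhat) * (h (i - 1) - k (i - 1)) + \<epsilon> * (h (i + 1) - k (i + 1)))"
      unfolding G by (simp add: algebra_simps power2_eq_square)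
    finally have "\<bar>2 * xd i * (G h i - G k i)\<bar> \<le> \<bar>rhat * (h (i - 1) - k (i - 1))\<bar> + \<bar>(h i + k i) * (h i - k i)\<bar>
        + \<bar>(r \<epsilon> - rhat) * (h (i - 1) - k (i - 1))\<bar> + \<bar>\<epsilon> * (h (i + 1) - k (i + 1))\<bar>"
      by linarith
    also have "\<dots> \<le> \<bar>rhat\<bar> * \<bar>h (i - 1) - k (i - 1)\<bar> + \<delta> * \<bar>h i - k i\<bar>
        + \<sigma> * \<bar>h (i - 1) - k (i - 1)\<bar> + \<epsilon> * \<bar>h (i + 1) - k (i + 1)\<bar> + 0"
    proof -
      have "\<bar>h i + k i\<bar> \<le> \<delta>" using hb[OF h, of i] hb[OF k, of i] by linarith
      from mult_right_mono[OF this, of "\<bar>h i - k i\<bar>"] show ?thesis using pos by (simp add: abs_mult)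
    qed
    finally have "w i * \<bar>G h i - G k i\<bar> \<le> \<theta> * d + c2 / (2 * m) * 0"
      by (rule weighted_estimate[where g = "\<lambda>j. h j - k j"]) (use d pos in auto)
    then show "w i * \<bar>G h i - G k i\<bar> \<le> \<theta> * d" by simp
  qed
  then obtain h where h: "\<And>i. w i * \<bar>h i\<bar> \<le> B" and Gh: "G h = h" by blast
  define x where "x = (\<lambda>i. xd i + h i)"
  have hb': "\<bar>h i\<bar> \<le> \<delta> / 2" for i by (rule hb[OF h])
  have "F r x \<epsilon> i = 0" for i
    using G[of i h] limit_eq[of i] unfolding Gh F_def x_def
    by (simp add: algebra_simps power2_eq_square)
  moreover have "\<bar>x i\<bar> \<le> M + \<delta> / 2" for i
    using hb'[of i] xd_bounds(2)[of i] unfolding x_def by linarith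
  then have "x \<in> linf" by (auto simp: linf_def bounded_iff)
  moreover have "\<bar>x i - xd i\<bar> < \<delta>" for i using hb'[of i] pos by (simp add: x_def)
  ultimately show ?thesis unfolding sol_set_def by blast
qed

lemma solution_ex1: "\<exists>!x. x \<in> sol_set r \<epsilon> \<and> (\<forall>i. \<bar>x i - xd i\<bar> < \<delta>)"
  using solution_exists solution_unique by blast

end

section \<open>Quasi-hyperbolicity for the Henon map\<close>

text \<open>The derivatives of the Henon map and of its inverse depend on the point through one
  scalar factor, so continuity in operator norm reduces to continuity of that scalar.\<close>

lemma C1_map_affine_derivative:
  fixes f :: "'a::euclidean_space \<Rightarrow> 'a" and A B :: "'a \<Rightarrow> 'a"
  assumes A: "bounded_linear A" and B: "bounded_linear B" and \<phi>: "continuous_on UNIV \<phi>"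
    and der: "\<And>z. (f has_derivative (\<lambda>v. \<phi> z *\<^sub>R A v + B v)) (at z)"
  shows "C1_map f"
proof -
  define f' where "f' z = \<phi> z *\<^sub>R Blinfun A + Blinfun B" for z
  have "blinfun_apply (f' z) = (\<lambda>v. \<phi> z *\<^sub>R A v + B v)" for z
    using A B by (simp add: f'_def fun_eq_iff plus_blinfun.rep_eq scaleR_blinfun.rep_eq bounded_linear_Blinfun_apply)
  moreover have "continuous_on UNIV f'"
    unfolding f'_def by (intro continuous_intros \<phi>)
  ultimately show ?thesis unfolding C1_map_def using der by metis
qed

definition henon_inv :: "real \<Rightarrow> real \<Rightarrow> real \<times> real \<Rightarrow> real \<times> real" where
  "henon_inv a b = (\<lambda>(x, y). (y, (sqrt a * (1 - y\<^sup>2) - x) / b))"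

lemma henon_has_derivative:
  "(henon a b has_derivative (\<lambda>v. (- 2 * sqrt a * fst z * fst v - b * snd v, fst v))) (at z)"
  unfolding henon_def case_prod_beta
  by (auto intro!: derivative_eq_intros simp: fun_eq_iff algebra_simps)

lemma henon_inv_has_derivative:
  "b \<noteq> 0 \<Longrightarrow> (henon_inv a b has_derivative
    (\<lambda>v. (snd v, (- 2 * sqrt a * snd z * snd v - fst v) / b))) (at z)"
  unfolding henon_inv_def case_prod_beta
  by (auto intro!: derivative_eq_intros simp: fun_eq_iff field_simps)

lemma C1_diffeomorphism_henon:
  assumes b: "b \<noteq> 0"
  shows "C1_diffeomorphism (henon a b)"
proof -
  have 1: "henon_inv a b (henon a b z) = z" and 2: "henon a b (henon_inv a b z) = z" for z
    using b by (cases z; simp add: henon_def henon_inv_def)+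
  have bij: "bij (henon a b)"
    by (rule o_bij[of "henon_inv a b"]) (simp_all add: fun_eq_iff 1 2)
  have inv: "inv (henon a b) = henon_inv a b"
    by (rule inv_equality) (simp_all add: 1 2)
  have "C1_map (henon a b)"
  proof (rule C1_map_affine_derivative[where A = "\<lambda>v. (- 2 * sqrt a * fst v, 0)" and \<phi> = fst
        and B = "\<lambda>v. (- b * snd v, fst v)"])
    show "(henon a b has_derivative
        (\<lambda>v. fst z *\<^sub>R (- 2 * sqrt a * fst v, 0) + (- b * snd v, fst v))) (at z)" for z
      by (rule has_derivative_eq_rhs[OF henon_has_derivative]) (simp add: fun_eq_iff)
  qed (intro bounded_linear_Pair bounded_linear_const_mult bounded_linear_fst
        bounded_linear_snd bounded_linear_zero continuous_intros)+
  moreover have "C1_map (henon_inv a b)"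
  proof (rule C1_map_affine_derivative[where A = "\<lambda>v. (0, (- 2 * sqrt a / b) * snd v)" and \<phi> = snd
        and B = "\<lambda>v. (snd v, (- 1 / b) * fst v)"])
    show "(henon_inv a b has_derivative
        (\<lambda>v. snd z *\<^sub>R (0, (- 2 * sqrt a / b) * snd v) + (snd v, (- 1 / b) * fst v))) (at z)" for z
      by (rule has_derivative_eq_rhs[OF henon_inv_has_derivative[OF b]])
        (simp add: fun_eq_iff diff_divide_distrib)
  qed (intro bounded_linear_Pair bounded_linear_const_mult bounded_linear_fst
        bounded_linear_snd bounded_linear_zero continuous_intros)+
  ultimately show ?thesis using bij inv by (simp add: C1_diffeomorphism_def)
qed

section \<open>Shifts of solutions and Henon orbits\<close>

lemma range_shift: "range (\<lambda>i. x (i + k)) = range x" for x :: "int \<Rightarrow> 'a" and k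
proof -
  have "x i \<in> range (\<lambda>i. x (i + k))" for i using rangeI[of "\<lambda>i. x (i + k)" "i - k"] by simp
  then show ?thesis by blast
qed

lemma sol_set_shift: "x \<in> sol_set r \<epsilon> \<Longrightarrow> (\<lambda>i. x (i + k)) \<in> sol_set r \<epsilon>"
proof -
  have "F r (\<lambda>i. x (i + k)) \<epsilon> i = F r x \<epsilon> (i + k)" for i
    by (simp add: F_def algebra_simps)
  then show "x \<in> sol_set r \<epsilon> \<Longrightarrow> (\<lambda>i. x (i + k)) \<in> sol_set r \<epsilon>"
    by (simp add: sol_set_def linf_def range_shift)
qed

lemma limit_sol_set_shift: "x \<in> limit_sol_set r rhat \<Longrightarrow> (\<lambda>i. x (i + k)) \<in> limit_sol_set r rhat"
  using sol_set_shift[of x r 0 k] unfolding limit_sol_set_def sol_set_def by simp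

lemma xstar_properties:
  assumes "\<exists>!x. x \<in> sol_set r \<epsilon> \<and> (\<forall>i. \<bar>x i - xd i\<bar> < \<delta>)"
  shows "xstar r \<delta> \<epsilon> xd \<in> sol_set r \<epsilon>" "\<bar>xstar r \<delta> \<epsilon> xd i - xd i\<bar> < \<delta>"
  using theI'[OF assms] unfolding xstar_def by auto

text \<open>The shifted continuation solves the shifted problem, so uniqueness identifies the two.
  This yields invariance of the continued set.\<close>

lemma xstar_shift:
  assumes "\<exists>!x. x \<in> sol_set r \<epsilon> \<and> (\<forall>i. \<bar>x i - xd i\<bar> < \<delta>)"
    and "\<exists>!x. x \<in> sol_set r \<epsilon> \<and> (\<forall>i. \<bar>x i - xd (i + k)\<bar> < \<delta>)"
  shows "xstar r \<delta> \<epsilon> (\<lambda>i. xd (i + k)) = (\<lambda>i. xstar r \<delta> \<epsilon> xd (i + k))"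
  unfolding xstar_def[of r \<delta> \<epsilon> "\<lambda>i. xd (i + k)"]
  by (rule the1_equality[OF assms(2)])
    (use xstar_properties[OF assms(1)] sol_set_shift in auto)

text \<open>For positive \<epsilon> this is \<open>F = 0\<close> divided by \<epsilon>, since
  \<open>sqrt (1 / \<epsilon>\<^sup>2) = 1 / \<epsilon>\<close>.\<close>

lemma henon_solution:
  assumes "0 < \<epsilon>" "x \<in> sol_set r \<epsilon>"
  shows "henon (1 / \<epsilon>\<^sup>2) (r \<epsilon> / \<epsilon>) (x i, x (i - 1)) = (x (i + 1), x i)"
proof -
  have "\<epsilon> * x (i + 1) = 1 - (x i)\<^sup>2 - r \<epsilon> * x (i - 1)"
  proof -
    have "F r x \<epsilon> i = 0" using assms(2) by (simp add: sol_set_def)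
    then show ?thesis unfolding F_def by linarith
  qed
  then have "x (i + 1) = (1 - (x i)\<^sup>2 - r \<epsilon> * x (i - 1)) / \<epsilon>"
    using assms(1) by (simp add: field_simps)
  then show ?thesis
    using assms(1) by (simp add: henon_def real_sqrt_divide diff_divide_distrib)
qed

text \<open>An orbit through the set consists of consecutive pairs of one continued solution, so the
  linear recurrence along it is the scalar second order equation in \<open>kernel\<close>.\<close>

lemma quasi_hyperbolic_continued_set:
  assumes \<epsilon>: "0 < \<epsilon>" and r0: "r \<epsilon> \<noteq> 0"
    and ex1: "\<And>xd. xd \<in> limit_sol_set r rhat \<Longrightarrow>
      \<exists>!x. x \<in> sol_set r \<epsilon> \<and> (\<forall>i. \<bar>x i - xd i\<bar> < \<delta>)"
    and kernel: "\<And>xd p i. \<lbrakk>xd \<in> limit_sol_set r rhat; bounded (range p);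
      \<And>i. \<epsilon> * p (i + 1) + 2 * xstar r \<delta> \<epsilon> xd i * p i + r \<epsilon> * p (i - 1) = 0\<rbrakk> \<Longrightarrow> p i = (0::real)"
  shows "quasi_hyperbolic (henon (1 / \<epsilon>\<^sup>2) (r \<epsilon> / \<epsilon>)) (continued_set r rhat \<delta> \<epsilon>)"
proof -
  let ?H = "henon (1 / \<epsilon>\<^sup>2) (r \<epsilon> / \<epsilon>)" and ?S = "continued_set r rhat \<delta> \<epsilon>" and ?X = "xstar r \<delta> \<epsilon>"
  have diffeo: "C1_diffeomorphism ?H" using r0 \<epsilon> by (intro C1_diffeomorphism_henon) simp
  then have inj: "inj ?H" by (simp add: C1_diffeomorphism_def bij_is_inj)
  have H: "?H (?X xd i, ?X xd (i - 1)) = (?X xd (i + 1), ?X xd i)" if "xd \<in> limit_sol_set r rhat" for xd i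
    using henon_solution[OF \<epsilon> xstar_properties(1)[OF ex1[OF that]]] .
  have mem: "(?X xd k, ?X xd (k - 1)) \<in> ?S" if "xd \<in> limit_sol_set r rhat" for xd k
  proof -
    note sh = limit_sol_set_shift[OF that, of k]
    have "?X (\<lambda>i. xd (i + k)) = (\<lambda>i. ?X xd (i + k))"
      by (rule xstar_shift[OF ex1[OF that] ex1[OF sh]])
    then have "(?X xd k, ?X xd (k - 1)) = (?X (\<lambda>i. xd (i + k)) 0, ?X (\<lambda>i. xd (i + k)) (-1))"
      by (simp add: algebra_simps)
    then show ?thesis using sh unfolding continued_set_def by blast
  qed
  have S: "\<exists>xd\<in>limit_sol_set r rhat. z = (?X xd 0, ?X xd (-1))" if "z \<in> ?S" for z
    using that unfolding continued_set_def by blast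
  have "?H ` ?S = ?S"
  proof (intro equalityI subsetI)
    fix z assume "z \<in> ?H ` ?S"
    then obtain xd where "xd \<in> limit_sol_set r rhat" "z = ?H (?X xd 0, ?X xd (0 - 1))"
      using S by fastforce
    then show "z \<in> ?S" using H[of xd 0] mem[of xd 1] by simp
  next
    fix z assume "z \<in> ?S"
    then obtain xd where xd: "xd \<in> limit_sol_set r rhat" "z = (?X xd 0, ?X xd (-1))" using S by blast
    then have "?H (?X xd (-1), ?X xd (-1 - 1)) = z" using H[of xd "-1"] by simp
    then show "z \<in> ?H ` ?S" using mem[OF xd(1), of "-1"] by blast
  qed
  moreover have "\<not> (\<exists>\<zeta> :: int \<Rightarrow> real \<times> real. bounded (range \<zeta>) \<and> (\<exists>i. \<zeta> i \<noteq> 0) \<and>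
      (\<forall>i. \<zeta> (i + 1) - frechet_derivative ?H (at (z i)) (\<zeta> i) = 0))"
    if z: "\<And>i :: int. z (i + 1) = ?H (z i)" and z0: "z 0 \<in> ?S" for z
  proof -
    obtain xd where xd: "xd \<in> limit_sol_set r rhat" and z0': "z 0 = (?X xd 0, ?X xd (-1))"
      using S[OF z0] by blast
    have zi: "z i = (?X xd i, ?X xd (i - 1))" for i
    proof (induction i rule: int_induct[where k = 0])
      case base
      then show ?case using z0' by simp
    next
      case (step1 i)
      then show ?case using z[of i] H[OF xd, of i] by simp
    next
      case (step2 i)
      \<comment> \<open>Backwards in time the orbit is determined only through injectivity of the
        Henon map.\<close>
      have "?H (z (i - 1)) = ?H (?X xd (i - 1), ?X xd (i - 1 - 1))"
        using z[of "i - 1"] step2 H[OF xd, of "i - 1"] by simp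
      then show ?case using inj by (simp add: inj_eq)
    qed
    have "\<zeta> i = 0" if bd: "bounded (range \<zeta>)"
      and eq: "\<And>i. \<zeta> (i + 1) - frechet_derivative ?H (at (z i)) (\<zeta> i) = 0" for \<zeta> i
    proof -
      define p where "p i = fst (\<zeta> i)" for i
      have e: "\<zeta> (i + 1) = (- 2 * (1 / \<epsilon>) * ?X xd i * fst (\<zeta> i) - r \<epsilon> / \<epsilon> * snd (\<zeta> i), fst (\<zeta> i))" for i
        using eq[of i] \<epsilon> unfolding frechet_derivative_at[OF henon_has_derivative, symmetric] zi
        by (simp add: real_sqrt_divide)
      \<comment> \<open>The second row of the derivative copies the first component, so a solution
        is determined by the scalar sequence \<open>p\<close>.\<close>
      have snd: "snd (\<zeta> i) = p (i - 1)" for i using e[of "i - 1"] by (simp add: p_def)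
      have p: "p (i + 1) = - 2 * (1 / \<epsilon>) * ?X xd i * p i - r \<epsilon> / \<epsilon> * p (i - 1)" for i
        using e[of i] unfolding snd by (simp add: p_def)
      have "\<epsilon> * p (i + 1) + 2 * ?X xd i * p i + r \<epsilon> * p (i - 1) = 0" for i
        unfolding p using \<epsilon> by (simp add: field_simps)
      moreover have "bounded (range p)"
        using bounded_fst[OF bd] by (simp add: p_def image_image)
      ultimately have "p j = 0" for j using kernel[OF xd] by blast
      then show ?thesis using snd[of i] by (simp add: prod_eq_iff p_def)
    qed
    then show ?thesis by blast
  qed
  ultimately show ?thesis using diffeo unfolding quasi_hyperbolic_def by auto
qed

section \<open>Uniform choice of constants and conclusion\<close>

theorem corollary11:
  fixes r r' :: "real \<Rightarrow> real" and rhat \<epsilon>bar :: real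
  assumes "0 < \<epsilon>bar"
    and "\<And>\<epsilon>. \<epsilon> \<in> {0..<\<epsilon>bar} \<Longrightarrow> (r has_real_derivative r' \<epsilon>) (at \<epsilon> within {0..<\<epsilon>bar})"
    and "continuous_on {0..<\<epsilon>bar} r'"
    and "\<And>\<epsilon>. \<epsilon> \<in> {0<..<\<epsilon>bar} \<Longrightarrow> r \<epsilon> \<noteq> 0"
    and "(r \<longlongrightarrow> rhat) (at_right 0)"
    and "r 0 = rhat"
    and "1 / ereal (rhat\<^sup>2) \<in> Hyp"
  shows "\<exists>\<epsilon>0 \<delta>0. 0 < \<epsilon>0 \<and> \<epsilon>0 \<le> \<epsilon>bar \<and> 0 < \<delta>0 \<and>
    (\<forall>xd \<in> limit_sol_set r rhat. \<forall>\<epsilon> \<in> {0..<\<epsilon>0}.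
       \<exists>!x. x \<in> sol_set r \<epsilon> \<and> (\<forall>i. \<bar>x i - xd i\<bar> < \<delta>0)) \<and>
    (\<forall>\<epsilon> \<in> {0<..<\<epsilon>0}.
       quasi_hyperbolic (henon (1 / \<epsilon>\<^sup>2) (r \<epsilon> / \<epsilon>)) (continued_set r rhat \<delta>0 \<epsilon>))"
proof -
  obtain m M \<kappa> c1 c2 where pos: "0 < m" "0 < M" "0 \<le> \<kappa>" "\<kappa> < 1" "0 < c1" "0 < c2"
    and wts: "\<And>x. x \<in> limit_sol_set r rhat \<Longrightarrow> (\<forall>i. m \<le> \<bar>x i\<bar> \<and> \<bar>x i\<bar> \<le> M) \<and>
      (\<exists>w. \<forall>i. c1 \<le> w i \<and> w i \<le> c2 \<and> \<bar>rhat\<bar> * w i \<le> \<kappa> * (2 * \<bar>x i\<bar> * w (i - 1)))"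
    using limit_sol_set_adapted_weights[of rhat r, OF assms(7,6)] by blast
  \<comment> \<open>The margin \<open>\<theta> - \<kappa> = (1 - \<kappa>) / 2\<close> is split
    evenly: \<open>2 * K * \<delta>\<close> uses one half, and the first bound in \<tau> allots the
    other to the perturbation. The second bound in \<tau> is \<open>defect\<close> solved for the
    perturbation size.\<close>
  define K where "K = c2 / (2 * m * c1)"
  define \<theta> where "\<theta> = (1 + \<kappa>) / 2"
  define \<delta> where "\<delta> = (1 - \<kappa>) / (8 * K)"
  define \<tau> where "\<tau> = min ((1 - \<kappa>) / (4 * K)) ((1 - \<theta>) * (c1 * \<delta> / 2) / (c2 / (2 * m) * M))"
  have K: "0 < K" using pos by (simp add: K_def)
  have \<theta>: "\<theta> < 1" using pos by (simp add: \<theta>_def)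
  have \<delta>: "0 < \<delta>" using pos K by (simp add: \<delta>_def)
  have \<tau>: "0 < \<tau>" using pos K \<theta> \<delta> by (simp add: \<tau>_def)
  have "\<forall>\<^sub>F \<epsilon> in at_right 0. dist (r \<epsilon>) rhat < \<tau> / 2"
    using assms(5) \<tau> by (intro tendstoD) auto
  then obtain e where e: "0 < e" "\<And>\<epsilon>. 0 < \<epsilon> \<Longrightarrow> \<epsilon> < e \<Longrightarrow> \<bar>r \<epsilon> - rhat\<bar> < \<tau> / 2"
    unfolding eventually_at_right_field dist_real_def by auto
  define \<epsilon>0 where "\<epsilon>0 = min \<epsilon>bar (min e (\<tau> / 2))"
  have \<epsilon>0: "0 < \<epsilon>0" "\<epsilon>0 \<le> \<epsilon>bar" "\<epsilon>0 \<le> e" "\<epsilon>0 \<le> \<tau> / 2"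
    using assms(1) e(1) \<tau> by (auto simp: \<epsilon>0_def)
  have adapted: "\<exists>w. adapted_limit_solution r rhat m M \<kappa> c1 c2 \<delta> \<theta> \<epsilon> xd w"
    if xd: "xd \<in> limit_sol_set r rhat" and \<epsilon>: "0 \<le> \<epsilon>" "\<epsilon> < \<epsilon>0" for xd \<epsilon>
  proof -
    obtain w where w: "\<And>i. c1 \<le> w i \<and> w i \<le> c2 \<and> \<bar>rhat\<bar> * w i \<le> \<kappa> * (2 * \<bar>xd i\<bar> * w (i - 1))"
      using wts[OF xd] by blast
    \<comment> \<open>The one-sided limit says nothing at \<open>\<epsilon> = 0\<close>; there
      \<open>r 0 = rhat\<close> is used.\<close>
    have "\<bar>r \<epsilon> - rhat\<bar> < \<tau> / 2" using e(2)[of \<epsilon>] \<epsilon> \<epsilon>0(3) assms(6) \<tau> by (cases "\<epsilon> = 0") auto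
    then have s: "\<bar>r \<epsilon> - rhat\<bar> + \<epsilon> \<le> \<tau>" using \<epsilon> \<epsilon>0(4) by linarith
    have "K * (2 * \<delta> + \<bar>r \<epsilon> - rhat\<bar> + \<epsilon>) \<le> K * (2 * \<delta> + (1 - \<kappa>) / (4 * K))"
      using s K by (intro mult_left_mono) (auto simp: \<tau>_def)
    also have "\<dots> = (1 - \<kappa>) / 2" using K by (simp add: \<delta>_def field_simps)
    finally have small: "\<kappa> + K * (2 * \<delta> + \<bar>r \<epsilon> - rhat\<bar> + \<epsilon>) \<le> \<theta>" by (simp add: \<theta>_def field_simps)
    have "c2 / (2 * m) * M * (\<bar>r \<epsilon> - rhat\<bar> + \<epsilon>) \<le>
        c2 / (2 * m) * M * ((1 - \<theta>) * (c1 * \<delta> / 2) / (c2 / (2 * m) * M))"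
      using s pos by (intro mult_left_mono) (auto simp: \<tau>_def)
    also have "\<dots> = (1 - \<theta>) * (c1 * \<delta> / 2)" using pos by simp
    finally have defect: "c2 / (2 * m) * ((\<bar>r \<epsilon> - rhat\<bar> + \<epsilon>) * M) \<le> (1 - \<theta>) * (c1 * \<delta> / 2)"
      by (simp add: mult_ac)
    have "rhat * xd (i - 1) = 1 - (xd i)\<^sup>2" for i
      using xd assms(6) by (simp add: limit_sol_set_def F_def algebra_simps)
    then have "adapted_limit_solution r rhat m M \<kappa> c1 c2 \<delta> \<theta> \<epsilon> xd w"
      using pos \<delta> \<epsilon> wts[OF xd] w small[unfolded K_def] defect \<theta> by unfold_locales auto
    then show ?thesis by blast
  qed
  have ex1: "\<exists>!x. x \<in> sol_set r \<epsilon> \<and> (\<forall>i. \<bar>x i - xd i\<bar> < \<delta>)"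
    if "xd \<in> limit_sol_set r rhat" "0 \<le> \<epsilon>" "\<epsilon> < \<epsilon>0" for xd \<epsilon>
    using adapted[OF that] adapted_limit_solution.solution_ex1 by blast
  have qh: "quasi_hyperbolic (henon (1 / \<epsilon>\<^sup>2) (r \<epsilon> / \<epsilon>)) (continued_set r rhat \<delta> \<epsilon>)"
    if \<epsilon>: "0 < \<epsilon>" "\<epsilon> < \<epsilon>0" for \<epsilon>
  proof (rule quasi_hyperbolic_continued_set)
    show "0 < \<epsilon>" "r \<epsilon> \<noteq> 0" using \<epsilon> \<epsilon>0(2) assms(4) by auto
    show "\<exists>!x. x \<in> sol_set r \<epsilon> \<and> (\<forall>i. \<bar>x i - xd i\<bar> < \<delta>)" if "xd \<in> limit_sol_set r rhat" for xd
      using ex1[OF that] \<epsilon> by simp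
    fix xd and p :: "int \<Rightarrow> real" and i
    assume xd: "xd \<in> limit_sol_set r rhat" and bd: "bounded (range p)"
      and eq: "\<And>i. \<epsilon> * p (i + 1) + 2 * xstar r \<delta> \<epsilon> xd i * p i + r \<epsilon> * p (i - 1) = 0"
    obtain w where "adapted_limit_solution r rhat m M \<kappa> c1 c2 \<delta> \<theta> \<epsilon> xd w"
      using adapted[OF xd, of \<epsilon>] \<epsilon> by auto
    then interpret adapted_limit_solution r rhat m M \<kappa> c1 c2 \<delta> \<theta> \<epsilon> xd w .
    have "\<bar>2 * xstar r \<delta> \<epsilon> xd j - 2 * xd j\<bar> \<le> 2 * \<delta>" for j
      using xstar_properties(2)[OF solution_ex1, of j] by linarith
    from bounded_kernel_trivial[OF bd this eq] show "p i = 0" .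
  qed
  show ?thesis
    by (rule exI[of _ \<epsilon>0], rule exI[of _ \<delta>], intro conjI ballI) (use \<epsilon>0 \<delta> ex1 qh in simp_all)
qed

end
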